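(* Let $\mathcal{A},\mathcal{B},\mathcal{C}$ be extriangulated categories with negative first extensions $\mathbb{E}^{-1}_{\mathcal{A}},\mathbb{E}^{-1}_{\mathcal{B}},\mathbb{E}^{-1}_{\mathcal{C}}$, all satisfying condition (WIC), and let $(\mathcal{A},\mathcal{B},\mathcal{C})$ be a recollement of extriangulated categories, with functors $i^*,i_*,i^!,j_!,j^*,j_*$. Suppose that $(\mathcal{X},\mathcal{Y})$ is a balanced pair in $\mathcal{B}$ with $j_!j^*\mathcal{X}\subseteq\mathcal{X}$, $j_*j^*\mathcal{Y}\subseteq\mathcal{Y}$, $i_*i^*\mathcal{X}\subseteq\mathcal{X}$ and $i_*i^!\mathcal{Y}\subseteq\mathcal{Y}$. (1) If $\mathbb{E}_{\mathcal{C}}^{-1}(\mathcal{C},j^*\mathcal{Y})=\mathbb{E}_{\mathcal{C}}^{-1}(j^*\mathcal{X},\mathcal{C})=0$ (i.e. $\mathbb{E}_{\mathcal{C}}^{-1}(C,j^*Y)=0$ and $\mathbb{E}_{\mathcal{C}}^{-1}(j^*X,C)=0$ for all $C\in\mathcal{C}$, $X\in\mathcal{X}$, $Y\in\mathcal{Y}$), then $(j^*\mathcal{X},j^*\mathcal{Y})$ is a balanced pair in $\mathcal{C}$. (2) If $i^*$ and $i^!$ are exact and $\mathbb{E}_{\mathcal{A}}^{-1}(i^*\mathcal{X},\mathcal{A})=\mathbb{E}_{\mathcal{A}}^{-1}(\mathcal{A},i^!\mathcal{Y})=0$ (i.e. $\mathbb{E}_{\mathcal{A}}^{-1}(i^*X,A)=0$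 and $\mathbb{E}_{\mathcal{A}}^{-1}(A,i^!Y)=0$ for all $A\in\mathcal{A}$, $X\in\mathcal{X}$, $Y\in\mathcal{Y}$), then $(i^*\mathcal{X},i^!\mathcal{Y})$ is a balanced pair in $\mathcal{A}$.
   Context: **Extriangulated category** (Nakaoka–Palu): a triple $(\mathcal{C},\mathbb{E},\mathfrak{s})$ where $\mathcal{C}$ is an additive category, $\mathbb{E}:\mathcal{C}^{\rm op}\times\mathcal{C}\to{\rm Ab}$ is an additive bifunctor, and $\mathfrak{s}$ assigns to each $\delta\in\mathbb{E}(C,A)$ an equivalence class $\mathfrak{s}(\delta)=[A\xrightarrow{x}B\xrightarrow{y}C]$ of sequences (two such sequences are equivalent if there is an isomorphism of middle terms commuting with the maps, with identities on $A$ and $C$). For $a:A\to A'$, $c:C'\to C$ write $a_*\delta=\mathbb{E}(C,a)(\delta)$, $c^*\delta=\mathbb{E}(c,A)(\delta)$. A morphism from $\delta\in\mathbb{E}(C,A)$ to $\delta'\in\mathbb{E}(C',A')$ is a pair $(a:A\to A',c:C\to C')$ with $a_*\delta=c^*\delta'$. Axioms: every morphism $(a,c):\delta\to\delta'$ extends to a commutative triple $(a,b,c)$ between realizing sequences; $\mathfrak{s}(0)=[A\to A\oplus C\to C]$ and $\mathfrak{s}(\delta\oplus\delta')=\mathfrak{s}(\delta)\oplus\mathfrak{s}(\delta')$; (ET3) if $\mathfrak{s}(\delta)=[A\xrightarrow{x}B\xrightarrow{y}C]$, $\mathfrak{s}(\delta')=[A'\xrightarrow{x'}B'\xrightarrow{y'}C']$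 and $bx=x'a$, there is $c$ with $cy=y'b$ and $a_*\delta=c^*\delta'$; (ET4) if $\delta\in\mathbb{E}(D,A)$, $\delta'\in\mathbb{E}(F,B)$ are realized by $A\xrightarrow{f}B\xrightarrow{f'}D$ and $B\xrightarrow{g}C\xrightarrow{g'}F$, there are an object $E$, $\delta''\in\mathbb{E}(E,A)$ realized by $A\xrightarrow{gf}C\xrightarrow{h'}E$, and maps $D\xrightarrow{d}E\xrightarrow{e}F$ realizing $f'_*\delta'$, with $h'g=df'$, $eh'=g'$, $d^*\delta''=\delta$, $f_*\delta''=e^*\delta'$; and the duals of (ET3), (ET4). If $\mathfrak{s}(\delta)=[A\xrightarrow{x}B\xrightarrow{y}C]$, then $A\xrightarrow{x}B\xrightarrow{y}C\overset{\delta}{\dashrightarrow}$ is called an $\mathbb{E}$-triangle, $x$ an inflation and $y$ a deflation. **Condition (WIC)**: for composable $f:X\to Y$, $g:Y\to Z$, if $gf$ is an inflation then so is $f$; if $gf$ is a deflation then so is $g$. **Negative first extension** on $\mathcal{C}$: an additive bifunctor $\mathbb{E}^{-1}:\mathcal{C}^{\rm op}\times\mathcal{C}\to{\rm Ab}$ together with, for each $\delta\in\mathbb{E}(C,A)$, natural transformations $\delta^{-1}_\sharp:\mathbb{E}^{-1}(-,C)\to\mathcal{C}(-,A)$ and $\delta^\sharp_{-1}:\mathbb{E}^{-1}(A,-)\to\mathcal{C}(C,-)$ such that for each $\mathbb{E}$-triangle $A\xrightarrow{f}B\xrightarrow{g}C\overset{\delta}{\dashrightarrow}$ the sequences $\mathbb{E}^{-1}(C,-)\to\mathbb{E}^{-1}(B,-)\to\mathbb{E}^{-1}(A,-)\xrightarrow{\delta^\sharp_{-1}}\mathcal{C}(C,-)\to\mathcal{C}(B,-)$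 and $\mathbb{E}^{-1}(-,A)\to\mathbb{E}^{-1}(-,B)\to\mathbb{E}^{-1}(-,C)\xrightarrow{\delta^{-1}_\sharp}\mathcal{C}(-,A)\to\mathcal{C}(-,B)$ (unnamed maps induced by $f,g$) are exact. **Compatible morphisms, exact sequences and functors** (Wang–Wei–Zhang). A morphism is compatible if it is an isomorphism whenever it is both an inflation and a deflation. A sequence $A\xrightarrow{f}B\xrightarrow{g}C$ is right exact if there are an $\mathbb{E}$-triangle $K\xrightarrow{h_2}B\xrightarrow{g}C\dashrightarrow$ and a compatible deflation $h_1:A\to K$ with $f=h_2h_1$; it is left exact if there are an $\mathbb{E}$-triangle $A\xrightarrow{f}B\xrightarrow{h_1}K\dashrightarrow$ and a compatible inflation $h_2:K\to C$ with $g=h_2h_1$. A 4-term sequence $A\xrightarrow{f}B\xrightarrow{g}C\xrightarrow{h}D$ is a right (resp. left) exact $\mathbb{E}$-triangle sequence if there are $\mathbb{E}$-triangles $A\xrightarrow{f}B\xrightarrow{g_1}K\dashrightarrow$ and $K\xrightarrow{g_2}C\xrightarrow{h}D\dashrightarrow$ with $g=g_2g_1$ and $g_1$ (resp. $g_2$) compatible. An additive functor $F:\mathcal{A}\to\mathcal{B}$ is exact if it preserves compatible morphisms and there is a natural transformation $\eta:\mathbb{E}_{\mathcal{A}}(-,-)\to\mathbb{E}_{\mathcal{B}}(F-,F-)$ such that $\mathfrak{s}_{\mathcal{A}}(\delta)=[A\xrightarrow{x}B\xrightarrow{y}C]$ implies $\mathfrak{s}_{\mathcal{B}}(\eta(\delta))=[FA\xrightarrow{Fx}FB\xrightarrow{Fy}FC]$.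 $F$ is right exact if it preserves compatible morphisms, preserves right exact sequences (so for each $\mathbb{E}_{\mathcal{A}}$-triangle $A\xrightarrow{f}B\xrightarrow{g}C\overset{\delta}{\dashrightarrow}$ there is an $\mathbb{E}_{\mathcal{B}}$-triangle $A'\xrightarrow{x}FB\xrightarrow{Fg}FC\dashrightarrow$ and a compatible deflation $y:FA\to A'$ with $Ff=xy$), and there is a natural transformation $\eta=\{\eta_{(C,A)}:\mathbb{E}_{\mathcal{A}}(C,A)\to\mathbb{E}_{\mathcal{B}}(FC,A')\}$ with $\mathfrak{s}_{\mathcal{B}}(\eta(\delta))=[A'\xrightarrow{x}FB\xrightarrow{Fg}FC]$. Left exact functors are defined dually. **Recollement** $(\mathcal{A},\mathcal{B},\mathcal{C})$ of extriangulated categories: exact functors $i_*:\mathcal{A}\to\mathcal{B}$, $j^*:\mathcal{B}\to\mathcal{C}$, right exact functors $i^*:\mathcal{B}\to\mathcal{A}$, $j_!:\mathcal{C}\to\mathcal{B}$, and left exact functors $i^!:\mathcal{B}\to\mathcal{A}$, $j_*:\mathcal{C}\to\mathcal{B}$ such that: (R1) $(i^*,i_*,i^!)$ and $(j_!,j^*,j_* )$ are adjoint triples; (R2) $\mathrm{Im}\,i_*=\mathrm{Ker}\,j^*$; (R3) $i_*,j_!,j_*$ are fully faithful; (R4) for each $X\in\mathcal{B}$ there is a left exact $\mathbb{E}_{\mathcal{B}}$-triangle sequence $i_*i^!X\to X\to j_*j^*X\to i_*A$ with $A\in\mathcal{A}$, the first two maps being the adjunction morphisms; (R5) for each $X\in\mathcal{B}$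 there is a right exact $\mathbb{E}_{\mathcal{B}}$-triangle sequence $i_*A'\to j_!j^*X\to X\to i_*i^*X$ with $A'\in\mathcal{A}$, the last two maps being the adjunction morphisms. **Balanced pair** in an extriangulated category $\mathcal{D}$ with a negative first extension. For a full additive subcategory $\mathcal{X}$, an $\mathbb{E}$-triangle $A\to B\to C\dashrightarrow$ is $\mathcal{D}(\mathcal{X},-)$-exact if $0\to\mathcal{D}(X,A)\to\mathcal{D}(X,B)\to\mathcal{D}(X,C)\to0$ is exact for all $X\in\mathcal{X}$; $\xi_{\mathcal{X}}$ is the class of all such $\mathbb{E}$-triangles. For a full additive subcategory $\mathcal{Y}$, it is $\mathcal{D}(-,\mathcal{Y})$-exact if $0\to\mathcal{D}(C,Y)\to\mathcal{D}(B,Y)\to\mathcal{D}(A,Y)\to0$ is exact for all $Y\in\mathcal{Y}$; $\xi^{\mathcal{Y}}$ is the class of all such $\mathbb{E}$-triangles. For a class $\xi$ of $\mathbb{E}$-triangles, $\mathcal{P}(\xi)$ is the full subcategory of objects $P$ such that $0\to\mathcal{D}(P,A)\to\mathcal{D}(P,B)\to\mathcal{D}(P,C)\to0$ is exact for every $A\to B\to C\dashrightarrow$ in $\xi$, and $\mathcal{I}(\xi)$ is defined dually; $\mathcal{D}$ has enough $\xi$-projectives (resp. $\xi$-injectives) if for each object $A$ there is $K\to P\to A\dashrightarrow$ (resp. $A\to I\to K\dashrightarrow$) in $\xi$ with $P\in\mathcal{P}(\xi)$ (resp. $I\in\mathcal{I}(\xi)$). A pair $(\mathcal{X},\mathcal{Y})$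 of full additive subcategories closed under direct summands is a balanced pair in $\mathcal{D}$ if $\xi_{\mathcal{X}}=\xi^{\mathcal{Y}}$, $\mathcal{X}=\mathcal{P}(\xi_{\mathcal{X}})$, $\mathcal{Y}=\mathcal{I}(\xi^{\mathcal{Y}})$, and $\mathcal{D}$ has enough $\xi_{\mathcal{X}}$-projectives and enough $\xi^{\mathcal{Y}}$-injectives. (The paper defines balanced pairs by this condition or by an equivalent one in terms of resolutions.) **Notation**: for a functor $F$ and a full subcategory $\mathcal{X}$, $F\mathcal{X}$ is the full subcategory of objects isomorphic to $FX$ for some $X\in\mathcal{X}$. *)

theory Defs
  imports "HOL-Algebra.Exact_Sequence"
begin

section \<open>Additive categories\<close>

text \<open>
  The abelian groups \<open>Hom C A B\<close> (and later the groups of extensions) are commutative groups in the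
  sense of \<^locale>\<open>comm_group\<close>, hence written multiplicatively: \<open>\<otimes>\<close> is the sum of two
  morphisms and \<open>\<one>\<close> is the zero morphism. Hom-sets of different pairs of objects are disjoint, so
  that a morphism determines its domain and codomain. Composition is in applicative order.
\<close>

record ('o, 'm) precat =
  Ob :: "'o set"
  Hom :: "'o \<Rightarrow> 'o \<Rightarrow> 'm monoid"
  Idn :: "'o \<Rightarrow> 'm"
  Cmp :: "'m \<Rightarrow> 'm \<Rightarrow> 'm"  (infixl \<open>\<cdot>\<index>\<close> 75)

abbreviation Mor :: "('o, 'm, 'z) precat_scheme \<Rightarrow> 'o \<Rightarrow> 'o \<Rightarrow> 'm set"
  where "Mor C A B \<equiv> carrier (Hom C A B)"

locale preadditive_category =
  fixes C :: "('o, 'm, 'z) precat_scheme" (structure)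
  assumes hom_comm_group: "\<lbrakk>A \<in> Ob C; B \<in> Ob C\<rbrakk> \<Longrightarrow> comm_group (Hom C A B)"
    and hom_disjoint:
      "\<lbrakk>A \<in> Ob C; B \<in> Ob C; A' \<in> Ob C; B' \<in> Ob C; f \<in> Mor C A B; f \<in> Mor C A' B'\<rbrakk>
        \<Longrightarrow> A = A' \<and> B = B'"
    and id_closed: "A \<in> Ob C \<Longrightarrow> Idn C A \<in> Mor C A A"
    and comp_closed:
      "\<lbrakk>X \<in> Ob C; Y \<in> Ob C; Z \<in> Ob C; f \<in> Mor C X Y; g \<in> Mor C Y Z\<rbrakk>
        \<Longrightarrow> g \<cdot> f \<in> Mor C X Z"
    and id_right: "\<lbrakk>X \<in> Ob C; Y \<in> Ob C; f \<in> Mor C X Y\<rbrakk> \<Longrightarrow> f \<cdot> Idn C X = f"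
    and id_left: "\<lbrakk>X \<in> Ob C; Y \<in> Ob C; f \<in> Mor C X Y\<rbrakk> \<Longrightarrow> Idn C Y \<cdot> f = f"
    and comp_assoc:
      "\<lbrakk>W \<in> Ob C; X \<in> Ob C; Y \<in> Ob C; Z \<in> Ob C;
        f \<in> Mor C W X; g \<in> Mor C X Y; h \<in> Mor C Y Z\<rbrakk>
        \<Longrightarrow> (h \<cdot> g) \<cdot> f = h \<cdot> (g \<cdot> f)"
    and comp_add_right:
      "\<lbrakk>X \<in> Ob C; Y \<in> Ob C; Z \<in> Ob C; f \<in> Mor C X Y; f' \<in> Mor C X Y; g \<in> Mor C Y Z\<rbrakk>
        \<Longrightarrow> g \<cdot> (f \<otimes>\<^bsub>Hom C X Y\<^esub> f') = (g \<cdot> f) \<otimes>\<^bsub>Hom C X Z\<^esub> (g \<cdot> f')"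
    and comp_add_left:
      "\<lbrakk>X \<in> Ob C; Y \<in> Ob C; Z \<in> Ob C; f \<in> Mor C X Y; g \<in> Mor C Y Z; g' \<in> Mor C Y Z\<rbrakk>
        \<Longrightarrow> (g \<otimes>\<^bsub>Hom C Y Z\<^esub> g') \<cdot> f = (g \<cdot> f) \<otimes>\<^bsub>Hom C X Z\<^esub> (g' \<cdot> f)"

definition is_iso :: "('o, 'm, 'z) precat_scheme \<Rightarrow> 'o \<Rightarrow> 'o \<Rightarrow> 'm \<Rightarrow> bool"
  where "is_iso C A B f \<longleftrightarrow> f \<in> Mor C A B \<and>
    (\<exists>g \<in> Mor C B A. g \<cdot>\<^bsub>C\<^esub> f = Idn C A \<and> f \<cdot>\<^bsub>C\<^esub> g = Idn C B)"

definition zero_object :: "('o, 'm, 'z) precat_scheme \<Rightarrow> 'o \<Rightarrow> bool"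
  where "zero_object C Z \<longleftrightarrow> Z \<in> Ob C \<and> Idn C Z = \<one>\<^bsub>Hom C Z Z\<^esub>"

definition biproduct ::
    "('o, 'm, 'z) precat_scheme \<Rightarrow> 'o \<Rightarrow> 'o \<Rightarrow> 'o \<Rightarrow> 'm \<Rightarrow> 'm \<Rightarrow> 'm \<Rightarrow> 'm \<Rightarrow> bool"
  where "biproduct C A B P i1 i2 p1 p2 \<longleftrightarrow>
    A \<in> Ob C \<and> B \<in> Ob C \<and> P \<in> Ob C \<and>
    i1 \<in> Mor C A P \<and> i2 \<in> Mor C B P \<and> p1 \<in> Mor C P A \<and> p2 \<in> Mor C P B \<and>
    p1 \<cdot>\<^bsub>C\<^esub> i1 = Idn C A \<and> p2 \<cdot>\<^bsub>C\<^esub> i2 = Idn C B \<and>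
    p1 \<cdot>\<^bsub>C\<^esub> i2 = \<one>\<^bsub>Hom C B A\<^esub> \<and> p2 \<cdot>\<^bsub>C\<^esub> i1 = \<one>\<^bsub>Hom C A B\<^esub> \<and>
    (i1 \<cdot>\<^bsub>C\<^esub> p1) \<otimes>\<^bsub>Hom C P P\<^esub> (i2 \<cdot>\<^bsub>C\<^esub> p2) = Idn C P"

locale additive_category = preadditive_category C
  for C :: "('o, 'm, 'z) precat_scheme" (structure) +
  assumes ex_zero_object: "\<exists>Z. zero_object C Z"
    and ex_biproduct:
      "\<lbrakk>A \<in> Ob C; B \<in> Ob C\<rbrakk> \<Longrightarrow> \<exists>P i1 i2 p1 p2. biproduct C A B P i1 i2 p1 p2"


section \<open>Additive bifunctors to abelian groups\<close>

text \<open>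
  \<open>BOb E D A\<close> is the group \<open>E(D, A)\<close>; for \<open>c : D' \<rightarrow> D\<close> and \<open>a : A \<rightarrow> A'\<close>,
  \<open>BMap E c a : E(D, A) \<rightarrow> E(D', A')\<close> is the map \<open>E(c, a)\<close>, contravariant in the first argument.
\<close>

record ('o, 'm, 'e) bifun =
  BOb :: "'o \<Rightarrow> 'o \<Rightarrow> 'e monoid"
  BMap :: "'m \<Rightarrow> 'm \<Rightarrow> 'e \<Rightarrow> 'e"

definition additive_bifunctor ::
    "('o, 'm, 'z) precat_scheme \<Rightarrow> ('o, 'm, 'e) bifun \<Rightarrow> bool"
  where "additive_bifunctor C E \<longleftrightarrow>
    (\<forall>D \<in> Ob C. \<forall>A \<in> Ob C. comm_group (BOb E D A)) \<and>
    (\<forall>D \<in> Ob C. \<forall>D' \<in> Ob C. \<forall>A \<in> Ob C. \<forall>A' \<in> Ob C. \<forall>c \<in> Mor C D' D. \<forall>a \<in> Mor C A A'.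
      BMap E c a \<in> hom (BOb E D A) (BOb E D' A')) \<and>
    (\<forall>D \<in> Ob C. \<forall>A \<in> Ob C. \<forall>\<delta> \<in> carrier (BOb E D A). BMap E (Idn C D) (Idn C A) \<delta> = \<delta>) \<and>
    (\<forall>D \<in> Ob C. \<forall>D' \<in> Ob C. \<forall>D'' \<in> Ob C. \<forall>A \<in> Ob C. \<forall>A' \<in> Ob C. \<forall>A'' \<in> Ob C.
      \<forall>c \<in> Mor C D' D. \<forall>c' \<in> Mor C D'' D'. \<forall>a \<in> Mor C A A'. \<forall>a' \<in> Mor C A' A''.
      \<forall>\<delta> \<in> carrier (BOb E D A).
      BMap E (c \<cdot>\<^bsub>C\<^esub> c') (a' \<cdot>\<^bsub>C\<^esub> a) \<delta> = BMap E c' a' (BMap E c a \<delta>)) \<and>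
    (\<forall>D \<in> Ob C. \<forall>D' \<in> Ob C. \<forall>A \<in> Ob C. \<forall>A' \<in> Ob C.
      \<forall>c \<in> Mor C D' D. \<forall>c' \<in> Mor C D' D. \<forall>a \<in> Mor C A A'. \<forall>\<delta> \<in> carrier (BOb E D A).
      BMap E (c \<otimes>\<^bsub>Hom C D' D\<^esub> c') a \<delta> = BMap E c a \<delta> \<otimes>\<^bsub>BOb E D' A'\<^esub> BMap E c' a \<delta>) \<and>
    (\<forall>D \<in> Ob C. \<forall>D' \<in> Ob C. \<forall>A \<in> Ob C. \<forall>A' \<in> Ob C.
      \<forall>c \<in> Mor C D' D. \<forall>a \<in> Mor C A A'. \<forall>a' \<in> Mor C A A'. \<forall>\<delta> \<in> carrier (BOb E D A).
      BMap E c (a \<otimes>\<^bsub>Hom C A A'\<^esub> a') \<delta> = BMap E c a \<delta> \<otimes>\<^bsub>BOb E D' A'\<^esub> BMap E c a' \<delta>)"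


section \<open>Extriangulated categories\<close>

text \<open>
  \<open>Rlz C D A \<delta>\<close> is the equivalence class of sequences that realizes \<open>\<delta> \<in> E(D, A)\<close>; a sequence
  \<open>A \<rightarrow> B \<rightarrow> D\<close> is represented by its pair of maps, which determines \<open>B\<close>.
\<close>

record ('o, 'm, 'e) extricat = "('o, 'm) precat" +
  Ext :: "('o, 'm, 'e) bifun"
  Rlz :: "'o \<Rightarrow> 'o \<Rightarrow> 'e \<Rightarrow> ('m \<times> 'm) set"

abbreviation Exts :: "('o, 'm, 'e, 'z) extricat_scheme \<Rightarrow> 'o \<Rightarrow> 'o \<Rightarrow> 'e set"
  where "Exts C D A \<equiv> carrier (BOb (Ext C) D A)"

text \<open>\<open>push C D a \<delta>\<close> is \<open>a\<^sub>*\<delta>\<close> for \<open>\<delta> \<in> E(D, A)\<close>, and \<open>pull C A c \<delta>\<close> is \<open>c\<^sup>*\<delta>\<close>.\<close>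

definition push :: "('o, 'm, 'e, 'z) extricat_scheme \<Rightarrow> 'o \<Rightarrow> 'm \<Rightarrow> 'e \<Rightarrow> 'e"
  where "push C D a \<delta> = BMap (Ext C) (Idn C D) a \<delta>"

definition pull :: "('o, 'm, 'e, 'z) extricat_scheme \<Rightarrow> 'o \<Rightarrow> 'm \<Rightarrow> 'e \<Rightarrow> 'e"
  where "pull C A c \<delta> = BMap (Ext C) c (Idn C A) \<delta>"

definition seqs :: "('o, 'm, 'z) precat_scheme \<Rightarrow> 'o \<Rightarrow> 'o \<Rightarrow> ('m \<times> 'm) set"
  where "seqs C A D = {(x, y). \<exists>B \<in> Ob C. x \<in> Mor C A B \<and> y \<in> Mor C B D}"

definition seq_equiv :: "('o, 'm, 'z) precat_scheme \<Rightarrow> 'o \<Rightarrow> 'o \<Rightarrow> (('m \<times> 'm) \<times> ('m \<times> 'm)) set"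
  where "seq_equiv C A D = {((x, y), (x', y')).
    \<exists>B \<in> Ob C. \<exists>B' \<in> Ob C. x \<in> Mor C A B \<and> y \<in> Mor C B D \<and> x' \<in> Mor C A B' \<and> y' \<in> Mor C B' D \<and>
      (\<exists>b. is_iso C B B' b \<and> b \<cdot>\<^bsub>C\<^esub> x = x' \<and> y' \<cdot>\<^bsub>C\<^esub> b = y)}"

text \<open>
  \<open>etriangle C A x B y D \<delta>\<close> says that \<open>A \<rightarrow> B \<rightarrow> D\<close> with maps \<open>x, y\<close> and \<open>\<delta> \<in> E(D, A)\<close> is an
  E-triangle. As \<open>Rlz C D A \<delta>\<close> is an equivalence class, \<open>(x, y) \<in> Rlz C D A \<delta>\<close> expresses that
  \<open>Rlz C D A \<delta>\<close> is the class of \<open>(x, y)\<close>.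
\<close>

definition etriangle ::
    "('o, 'm, 'e, 'z) extricat_scheme \<Rightarrow> 'o \<Rightarrow> 'm \<Rightarrow> 'o \<Rightarrow> 'm \<Rightarrow> 'o \<Rightarrow> 'e \<Rightarrow> bool"
  where "etriangle C A x B y D \<delta> \<longleftrightarrow>
    A \<in> Ob C \<and> B \<in> Ob C \<and> D \<in> Ob C \<and> x \<in> Mor C A B \<and> y \<in> Mor C B D \<and>
    \<delta> \<in> Exts C D A \<and> (x, y) \<in> Rlz C D A \<delta>"

locale extriangulated_category = additive_category C
  for C :: "('o, 'm, 'e, 'z) extricat_scheme" (structure) +
  assumes ext_bifunctor: "additive_bifunctor C (Ext C)"
    and realization_class:
      "\<lbrakk>D \<in> Ob C; A \<in> Ob C; \<delta> \<in> Exts C D A\<rbrakk> \<Longrightarrow> Rlz C D A \<delta> \<in> seqs C A D // seq_equiv C A D"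
    and realization_morphism:
      "\<lbrakk>etriangle C A x B y D \<delta>; etriangle C A' x' B' y' D' \<delta>';
        a \<in> Mor C A A'; c \<in> Mor C D D'; push C D a \<delta> = pull C A' c \<delta>'\<rbrakk>
        \<Longrightarrow> \<exists>b \<in> Mor C B B'. b \<cdot> x = x' \<cdot> a \<and> c \<cdot> y = y' \<cdot> b"
    and realization_zero:
      "biproduct C A D P i1 i2 p1 p2 \<Longrightarrow> etriangle C A i1 P p2 D \<one>\<^bsub>BOb (Ext C) D A\<^esub>"
    and realization_sum:
      "\<lbrakk>etriangle C A x B y D \<delta>; etriangle C A' x' B' y' D' \<delta>';
        biproduct C A A' AA iA iA' pA pA'; biproduct C B B' BB iB iB' pB pB';
        biproduct C D D' DD iD iD' pD pD'\<rbrakk>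
        \<Longrightarrow> etriangle C
              AA ((iB \<cdot> x \<cdot> pA) \<otimes>\<^bsub>Hom C AA BB\<^esub> (iB' \<cdot> x' \<cdot> pA'))
              BB ((iD \<cdot> y \<cdot> pB) \<otimes>\<^bsub>Hom C BB DD\<^esub> (iD' \<cdot> y' \<cdot> pB'))
              DD (BMap (Ext C) pD iA \<delta> \<otimes>\<^bsub>BOb (Ext C) DD AA\<^esub> BMap (Ext C) pD' iA' \<delta>')"
    and ET3:
      "\<lbrakk>etriangle C A x B y D \<delta>; etriangle C A' x' B' y' D' \<delta>';
        a \<in> Mor C A A'; b \<in> Mor C B B'; b \<cdot> x = x' \<cdot> a\<rbrakk>
        \<Longrightarrow> \<exists>c \<in> Mor C D D'. c \<cdot> y = y' \<cdot> b \<and> push C D a \<delta> = pull C A' c \<delta>'"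
    and ET3_op:
      "\<lbrakk>etriangle C A x B y D \<delta>; etriangle C A' x' B' y' D' \<delta>';
        b \<in> Mor C B B'; c \<in> Mor C D D'; c \<cdot> y = y' \<cdot> b\<rbrakk>
        \<Longrightarrow> \<exists>a \<in> Mor C A A'. b \<cdot> x = x' \<cdot> a \<and> push C D a \<delta> = pull C A' c \<delta>'"
    and ET4:
      "\<lbrakk>etriangle C A f B f' D \<delta>; etriangle C B g G g' F \<delta>'\<rbrakk>
        \<Longrightarrow> \<exists>E h' d e \<delta>''. etriangle C A (g \<cdot> f) G h' E \<delta>'' \<and>
              etriangle C D d E e F (push C F f' \<delta>') \<and>
              h' \<cdot> g = d \<cdot> f' \<and> e \<cdot> h' = g' \<and>
              pull C A d \<delta>'' = \<delta> \<and> push C E f \<delta>'' = pull C B e \<delta>'"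
    and ET4_op:
      "\<lbrakk>etriangle C D f' A f B \<delta>; etriangle C F g' B g G \<delta>'\<rbrakk>
        \<Longrightarrow> \<exists>E h' d e \<delta>''. etriangle C E h' A (g \<cdot> f) G \<delta>'' \<and>
              etriangle C D d E e F (pull C D g' \<delta>) \<and>
              f \<cdot> h' = g' \<cdot> e \<and> h' \<cdot> d = f' \<and>
              push C G e \<delta>'' = \<delta>' \<and> push C B d \<delta> = pull C E g \<delta>''"

definition inflation :: "('o, 'm, 'e, 'z) extricat_scheme \<Rightarrow> 'm \<Rightarrow> bool"
  where "inflation C x \<longleftrightarrow> (\<exists>A B y D \<delta>. etriangle C A x B y D \<delta>)"

definition deflation :: "('o, 'm, 'e, 'z) extricat_scheme \<Rightarrow> 'm \<Rightarrow> bool"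
  where "deflation C y \<longleftrightarrow> (\<exists>A x B D \<delta>. etriangle C A x B y D \<delta>)"

definition WIC :: "('o, 'm, 'e, 'z) extricat_scheme \<Rightarrow> bool"
  where "WIC C \<longleftrightarrow>
    (\<forall>X \<in> Ob C. \<forall>Y \<in> Ob C. \<forall>Z \<in> Ob C. \<forall>f \<in> Mor C X Y. \<forall>g \<in> Mor C Y Z.
      (inflation C (g \<cdot>\<^bsub>C\<^esub> f) \<longrightarrow> inflation C f) \<and>
      (deflation C (g \<cdot>\<^bsub>C\<^esub> f) \<longrightarrow> deflation C g))"


section \<open>Negative first extensions\<close>

text \<open>
  For \<open>\<delta> \<in> E(D, A)\<close>, \<open>sharp_lower N D A \<delta> W\<close> is the component at \<open>W\<close> of the transformation
  \<open>E\<^sup>-\<^sup>1(-, D) \<rightarrow> C(-, A)\<close>, and \<open>sharp_upper N D A \<delta> W\<close> that of \<open>E\<^sup>-\<^sup>1(A, -) \<rightarrow> C(D, -)\<close>.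
\<close>

record ('o, 'm, 'e, 'n) negext =
  NExt :: "('o, 'm, 'n) bifun"
  sharp_lower :: "'o \<Rightarrow> 'o \<Rightarrow> 'e \<Rightarrow> 'o \<Rightarrow> 'n \<Rightarrow> 'm"
  sharp_upper :: "'o \<Rightarrow> 'o \<Rightarrow> 'e \<Rightarrow> 'o \<Rightarrow> 'n \<Rightarrow> 'm"

text \<open>
  Exactness of \<open>G \<rightarrow> H \<rightarrow> K\<close> at \<open>H\<close>. The library's \<^const>\<open>exact_seq\<close> needs all groups to have
  elements of one type, which is not the case for the sequences below.
\<close>

definition exact_at :: "'a monoid \<Rightarrow> 'b monoid \<Rightarrow> 'c monoid \<Rightarrow> ('a \<Rightarrow> 'b) \<Rightarrow> ('b \<Rightarrow> 'c) \<Rightarrow> bool"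
  where "exact_at G H K f g \<longleftrightarrow> f \<in> hom G H \<and> g \<in> hom H K \<and> f ` carrier G = kernel H K g"

locale negative_first_extension =
  fixes C :: "('o, 'm, 'e, 'z) extricat_scheme" (structure)
    and N :: "('o, 'm, 'e, 'n) negext"
  assumes neg_bifunctor: "additive_bifunctor C (NExt N)"
    and sharp_lower_hom:
      "\<lbrakk>D \<in> Ob C; A \<in> Ob C; \<delta> \<in> Exts C D A; W \<in> Ob C\<rbrakk>
        \<Longrightarrow> sharp_lower N D A \<delta> W \<in> hom (BOb (NExt N) W D) (Hom C W A)"
    and sharp_lower_natural:
      "\<lbrakk>D \<in> Ob C; A \<in> Ob C; \<delta> \<in> Exts C D A; W \<in> Ob C; W' \<in> Ob C; w \<in> Mor C W' W;
        \<phi> \<in> carrier (BOb (NExt N) W D)\<rbrakk>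
        \<Longrightarrow> sharp_lower N D A \<delta> W' (BMap (NExt N) w (Idn C D) \<phi>) = sharp_lower N D A \<delta> W \<phi> \<cdot> w"
    and sharp_upper_hom:
      "\<lbrakk>D \<in> Ob C; A \<in> Ob C; \<delta> \<in> Exts C D A; W \<in> Ob C\<rbrakk>
        \<Longrightarrow> sharp_upper N D A \<delta> W \<in> hom (BOb (NExt N) A W) (Hom C D W)"
    and sharp_upper_natural:
      "\<lbrakk>D \<in> Ob C; A \<in> Ob C; \<delta> \<in> Exts C D A; W \<in> Ob C; W' \<in> Ob C; w \<in> Mor C W W';
        \<phi> \<in> carrier (BOb (NExt N) A W)\<rbrakk>
        \<Longrightarrow> sharp_upper N D A \<delta> W' (BMap (NExt N) (Idn C A) w \<phi>) = w \<cdot> sharp_upper N D A \<delta> W \<phi>"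
    and neg_exact_upper:
      "\<lbrakk>etriangle C A f B g D \<delta>; W \<in> Ob C\<rbrakk> \<Longrightarrow>
        exact_at (BOb (NExt N) D W) (BOb (NExt N) B W) (BOb (NExt N) A W)
          (BMap (NExt N) g (Idn C W)) (BMap (NExt N) f (Idn C W)) \<and>
        exact_at (BOb (NExt N) B W) (BOb (NExt N) A W) (Hom C D W)
          (BMap (NExt N) f (Idn C W)) (sharp_upper N D A \<delta> W) \<and>
        exact_at (BOb (NExt N) A W) (Hom C D W) (Hom C B W)
          (sharp_upper N D A \<delta> W) (\<lambda>u. u \<cdot> g)"
    and neg_exact_lower:
      "\<lbrakk>etriangle C A f B g D \<delta>; W \<in> Ob C\<rbrakk> \<Longrightarrow>
        exact_at (BOb (NExt N) W A) (BOb (NExt N) W B) (BOb (NExt N) W D)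
          (BMap (NExt N) (Idn C W) f) (BMap (NExt N) (Idn C W) g) \<and>
        exact_at (BOb (NExt N) W B) (BOb (NExt N) W D) (Hom C W A)
          (BMap (NExt N) (Idn C W) g) (sharp_lower N D A \<delta> W) \<and>
        exact_at (BOb (NExt N) W D) (Hom C W A) (Hom C W B)
          (sharp_lower N D A \<delta> W) (\<lambda>u. f \<cdot> u)"


section \<open>Compatible morphisms and exact sequences\<close>

definition compatible :: "('o, 'm, 'e, 'z) extricat_scheme \<Rightarrow> 'o \<Rightarrow> 'o \<Rightarrow> 'm \<Rightarrow> bool"
  where "compatible C A B f \<longleftrightarrow>
    f \<in> Mor C A B \<and> (inflation C f \<and> deflation C f \<longrightarrow> is_iso C A B f)"

definition right_exact_seq ::
    "('o, 'm, 'e, 'z) extricat_scheme \<Rightarrow> 'o \<Rightarrow> 'm \<Rightarrow> 'o \<Rightarrow> 'm \<Rightarrow> 'o \<Rightarrow> bool"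
  where "right_exact_seq C A f B g D \<longleftrightarrow> A \<in> Ob C \<and>
    (\<exists>K h1 h2 \<delta>. etriangle C K h2 B g D \<delta> \<and> compatible C A K h1 \<and> deflation C h1 \<and>
      f = h2 \<cdot>\<^bsub>C\<^esub> h1)"

definition left_exact_seq ::
    "('o, 'm, 'e, 'z) extricat_scheme \<Rightarrow> 'o \<Rightarrow> 'm \<Rightarrow> 'o \<Rightarrow> 'm \<Rightarrow> 'o \<Rightarrow> bool"
  where "left_exact_seq C A f B g D \<longleftrightarrow> D \<in> Ob C \<and>
    (\<exists>K h1 h2 \<delta>. etriangle C A f B h1 K \<delta> \<and> compatible C K D h2 \<and> inflation C h2 \<and>
      g = h2 \<cdot>\<^bsub>C\<^esub> h1)"

definition right_exact_etriangle_seq ::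
    "('o, 'm, 'e, 'z) extricat_scheme \<Rightarrow> 'o \<Rightarrow> 'm \<Rightarrow> 'o \<Rightarrow> 'm \<Rightarrow> 'o \<Rightarrow> 'm \<Rightarrow> 'o \<Rightarrow> bool"
  where "right_exact_etriangle_seq C A f B g D h G \<longleftrightarrow>
    (\<exists>K g1 g2 \<delta> \<delta>'. etriangle C A f B g1 K \<delta> \<and> etriangle C K g2 D h G \<delta>' \<and>
      g = g2 \<cdot>\<^bsub>C\<^esub> g1 \<and> compatible C B K g1)"

definition left_exact_etriangle_seq ::
    "('o, 'm, 'e, 'z) extricat_scheme \<Rightarrow> 'o \<Rightarrow> 'm \<Rightarrow> 'o \<Rightarrow> 'm \<Rightarrow> 'o \<Rightarrow> 'm \<Rightarrow> 'o \<Rightarrow> bool"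
  where "left_exact_etriangle_seq C A f B g D h G \<longleftrightarrow>
    (\<exists>K g1 g2 \<delta> \<delta>'. etriangle C A f B g1 K \<delta> \<and> etriangle C K g2 D h G \<delta>' \<and>
      g = g2 \<cdot>\<^bsub>C\<^esub> g1 \<and> compatible C K D g2)"


section \<open>Functors\<close>

record ('o, 'm, 'p, 'n) functor_data =
  FOb :: "'o \<Rightarrow> 'p"
  FMor :: "'m \<Rightarrow> 'n"

definition additive_functor ::
    "('o, 'm, 'y) precat_scheme \<Rightarrow> ('p, 'n, 'z) precat_scheme \<Rightarrow> ('o, 'm, 'p, 'n) functor_data \<Rightarrow> bool"
  where "additive_functor C D F \<longleftrightarrow>
    (\<forall>A \<in> Ob C. FOb F A \<in> Ob D) \<and>
    (\<forall>A \<in> Ob C. \<forall>B \<in> Ob C. FMor F \<in> hom (Hom C A B) (Hom D (FOb F A) (FOb F B))) \<and>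
    (\<forall>A \<in> Ob C. FMor F (Idn C A) = Idn D (FOb F A)) \<and>
    (\<forall>X \<in> Ob C. \<forall>Y \<in> Ob C. \<forall>Z \<in> Ob C. \<forall>f \<in> Mor C X Y. \<forall>g \<in> Mor C Y Z.
      FMor F (g \<cdot>\<^bsub>C\<^esub> f) = FMor F g \<cdot>\<^bsub>D\<^esub> FMor F f)"

definition preserves_compatible ::
    "('o, 'm, 'e, 'y) extricat_scheme \<Rightarrow> ('p, 'n, 'f, 'z) extricat_scheme \<Rightarrow>
      ('o, 'm, 'p, 'n) functor_data \<Rightarrow> bool"
  where "preserves_compatible C D F \<longleftrightarrow>
    (\<forall>A \<in> Ob C. \<forall>B \<in> Ob C. \<forall>f. compatible C A B f \<longrightarrow> compatible D (FOb F A) (FOb F B) (FMor F f))"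

definition exact_functor ::
    "('o, 'm, 'e, 'y) extricat_scheme \<Rightarrow> ('p, 'n, 'f, 'z) extricat_scheme \<Rightarrow>
      ('o, 'm, 'p, 'n) functor_data \<Rightarrow> bool"
  where "exact_functor C D F \<longleftrightarrow> additive_functor C D F \<and> preserves_compatible C D F \<and>
    (\<exists>\<eta>.
      (\<forall>X \<in> Ob C. \<forall>A \<in> Ob C.
        \<eta> X A \<in> hom (BOb (Ext C) X A) (BOb (Ext D) (FOb F X) (FOb F A))) \<and>
      (\<forall>X \<in> Ob C. \<forall>X' \<in> Ob C. \<forall>A \<in> Ob C. \<forall>A' \<in> Ob C. \<forall>c \<in> Mor C X' X. \<forall>a \<in> Mor C A A'.
        \<forall>\<delta> \<in> Exts C X A.
        \<eta> X' A' (BMap (Ext C) c a \<delta>) = BMap (Ext D) (FMor F c) (FMor F a) (\<eta> X A \<delta>)) \<and>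
      (\<forall>A x B y X \<delta>. etriangle C A x B y X \<delta> \<longrightarrow>
        etriangle D (FOb F A) (FMor F x) (FOb F B) (FMor F y) (FOb F X) (\<eta> X A \<delta>)))"

text \<open>
  In the definition of a right exact functor \<open>F\<close> the object \<open>A'\<close> of the induced E-triangle
  \<open>A' \<rightarrow> F B \<rightarrow> F X\<close> depends on \<open>\<delta> \<in> E(X, A)\<close>; here it is \<open>K X A \<delta>\<close>, and the compatible deflation
  \<open>F A \<rightarrow> A'\<close> is \<open>y X A \<delta>\<close>. Therefore \<open>\<eta>(a\<^sub>*\<delta>)\<close> and \<open>\<eta>(c\<^sup>*\<delta>)\<close> are extensions by different objects,
  and naturality of \<open>\<eta>\<close> is expressed on morphisms of extensions: if \<open>(a, c) : \<delta> \<rightarrow> \<delta>'\<close> is one, then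
  \<open>F a\<close> induces a map \<open>m\<close> between the objects \<open>A'\<close> such that \<open>(m, F c) : \<eta> \<delta> \<rightarrow> \<eta> \<delta>'\<close> is one. If
  \<open>A' = F A\<close> and \<open>y\<close> is the identity throughout, this is naturality in the usual sense (and \<open>\<eta>\<close> is
  then automatically additive).
\<close>

definition right_exact_functor ::
    "('o, 'm, 'e, 'y) extricat_scheme \<Rightarrow> ('p, 'n, 'f, 'z) extricat_scheme \<Rightarrow>
      ('o, 'm, 'p, 'n) functor_data \<Rightarrow> bool"
  where "right_exact_functor C D F \<longleftrightarrow> additive_functor C D F \<and> preserves_compatible C D F \<and>
    (\<forall>A f B g X. right_exact_seq C A f B g X \<longrightarrow>
      right_exact_seq D (FOb F A) (FMor F f) (FOb F B) (FMor F g) (FOb F X)) \<and>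
    (\<exists>K y \<eta>.
      (\<forall>X \<in> Ob C. \<forall>A \<in> Ob C. \<forall>\<delta> \<in> Exts C X A.
        K X A \<delta> \<in> Ob D \<and> compatible D (FOb F A) (K X A \<delta>) (y X A \<delta>) \<and> deflation D (y X A \<delta>) \<and>
        \<eta> X A \<delta> \<in> Exts D (FOb F X) (K X A \<delta>)) \<and>
      (\<forall>A f B g X \<delta>. etriangle C A f B g X \<delta> \<longrightarrow>
        (\<exists>x. etriangle D (K X A \<delta>) x (FOb F B) (FMor F g) (FOb F X) (\<eta> X A \<delta>) \<and>
          FMor F f = x \<cdot>\<^bsub>D\<^esub> y X A \<delta>)) \<and>
      (\<forall>X \<in> Ob C. \<forall>X' \<in> Ob C. \<forall>A \<in> Ob C. \<forall>A' \<in> Ob C. \<forall>\<delta> \<in> Exts C X A. \<forall>\<delta>' \<in> Exts C X' A'.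
        \<forall>a \<in> Mor C A A'. \<forall>c \<in> Mor C X X'. push C X a \<delta> = pull C A' c \<delta>' \<longrightarrow>
        (\<exists>m \<in> Mor D (K X A \<delta>) (K X' A' \<delta>').
          m \<cdot>\<^bsub>D\<^esub> y X A \<delta> = y X' A' \<delta>' \<cdot>\<^bsub>D\<^esub> FMor F a \<and>
          push D (FOb F X) m (\<eta> X A \<delta>) = pull D (K X' A' \<delta>') (FMor F c) (\<eta> X' A' \<delta>'))))"

definition left_exact_functor ::
    "('o, 'm, 'e, 'y) extricat_scheme \<Rightarrow> ('p, 'n, 'f, 'z) extricat_scheme \<Rightarrow>
      ('o, 'm, 'p, 'n) functor_data \<Rightarrow> bool"
  where "left_exact_functor C D F \<longleftrightarrow> additive_functor C D F \<and> preserves_compatible C D F \<and>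
    (\<forall>A f B g X. left_exact_seq C A f B g X \<longrightarrow>
      left_exact_seq D (FOb F A) (FMor F f) (FOb F B) (FMor F g) (FOb F X)) \<and>
    (\<exists>K y \<eta>.
      (\<forall>X \<in> Ob C. \<forall>A \<in> Ob C. \<forall>\<delta> \<in> Exts C X A.
        K X A \<delta> \<in> Ob D \<and> compatible D (K X A \<delta>) (FOb F X) (y X A \<delta>) \<and> inflation D (y X A \<delta>) \<and>
        \<eta> X A \<delta> \<in> Exts D (K X A \<delta>) (FOb F A)) \<and>
      (\<forall>A f B g X \<delta>. etriangle C A f B g X \<delta> \<longrightarrow>
        (\<exists>x. etriangle D (FOb F A) (FMor F f) (FOb F B) x (K X A \<delta>) (\<eta> X A \<delta>) \<and>
          FMor F g = y X A \<delta> \<cdot>\<^bsub>D\<^esub> x)) \<and>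
      (\<forall>X \<in> Ob C. \<forall>X' \<in> Ob C. \<forall>A \<in> Ob C. \<forall>A' \<in> Ob C. \<forall>\<delta> \<in> Exts C X A. \<forall>\<delta>' \<in> Exts C X' A'.
        \<forall>a \<in> Mor C A A'. \<forall>c \<in> Mor C X X'. push C X a \<delta> = pull C A' c \<delta>' \<longrightarrow>
        (\<exists>m \<in> Mor D (K X A \<delta>) (K X' A' \<delta>').
          y X' A' \<delta>' \<cdot>\<^bsub>D\<^esub> m = FMor F c \<cdot>\<^bsub>D\<^esub> y X A \<delta> \<and>
          push D (K X A \<delta>) (FMor F a) (\<eta> X A \<delta>) = pull D (FOb F A') m (\<eta> X' A' \<delta>'))))"

definition fully_faithful ::
    "('o, 'm, 'y) precat_scheme \<Rightarrow> ('p, 'n, 'z) precat_scheme \<Rightarrow> ('o, 'm, 'p, 'n) functor_data \<Rightarrow> bool"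
  where "fully_faithful C D F \<longleftrightarrow>
    (\<forall>A \<in> Ob C. \<forall>B \<in> Ob C. bij_betw (FMor F) (Mor C A B) (Mor D (FOb F A) (FOb F B)))"

text \<open>\<open>ess_image D F S\<close> is the full subcategory \<open>F S\<close>: all objects isomorphic to some \<open>F X\<close>, \<open>X \<in> S\<close>.\<close>

definition ess_image ::
    "('p, 'n, 'z) precat_scheme \<Rightarrow> ('o, 'm, 'p, 'n) functor_data \<Rightarrow> 'o set \<Rightarrow> 'p set"
  where "ess_image D F S = {B \<in> Ob D. \<exists>X \<in> S. \<exists>f. is_iso D (FOb F X) B f}"

text \<open>\<open>F : C \<rightarrow> D\<close> is left adjoint to \<open>G : D \<rightarrow> C\<close> with unit \<open>u\<close> and counit \<open>v\<close>.\<close>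

definition adjunction ::
    "('o, 'm, 'y) precat_scheme \<Rightarrow> ('p, 'n, 'z) precat_scheme \<Rightarrow>
      ('o, 'm, 'p, 'n) functor_data \<Rightarrow> ('p, 'n, 'o, 'm) functor_data \<Rightarrow>
      ('o \<Rightarrow> 'm) \<Rightarrow> ('p \<Rightarrow> 'n) \<Rightarrow> bool"
  where "adjunction C D F G u v \<longleftrightarrow>
    (\<forall>X \<in> Ob C. u X \<in> Mor C X (FOb G (FOb F X))) \<and>
    (\<forall>Y \<in> Ob D. v Y \<in> Mor D (FOb F (FOb G Y)) Y) \<and>
    (\<forall>X \<in> Ob C. \<forall>X' \<in> Ob C. \<forall>f \<in> Mor C X X'. u X' \<cdot>\<^bsub>C\<^esub> f = FMor G (FMor F f) \<cdot>\<^bsub>C\<^esub> u X) \<and>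
    (\<forall>Y \<in> Ob D. \<forall>Y' \<in> Ob D. \<forall>g \<in> Mor D Y Y'. g \<cdot>\<^bsub>D\<^esub> v Y = v Y' \<cdot>\<^bsub>D\<^esub> FMor F (FMor G g)) \<and>
    (\<forall>X \<in> Ob C. v (FOb F X) \<cdot>\<^bsub>D\<^esub> FMor F (u X) = Idn D (FOb F X)) \<and>
    (\<forall>Y \<in> Ob D. FMor G (v Y) \<cdot>\<^bsub>C\<^esub> u (FOb G Y) = Idn C (FOb G Y))"


section \<open>Recollements\<close>

text \<open>
  The functors are, in order, \<open>i\<^sup>*\<close>, \<open>i\<^sub>*\<close>, \<open>i\<^sup>!\<close>, \<open>j\<^sub>!\<close>, \<open>j\<^sup>*\<close>, \<open>j\<^sub>*\<close>. The adjunction morphisms in the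
  last two conditions are those of the adjunctions \<open>(i\<^sub>*, i\<^sup>!)\<close>, \<open>(j\<^sup>*, j\<^sub>*)\<close> and
  \<open>(j\<^sub>!, j\<^sup>*)\<close>, \<open>(i\<^sup>*, i\<^sub>*)\<close>, respectively.
\<close>

definition recollement ::
    "('oa, 'ma, 'ea, 'za) extricat_scheme \<Rightarrow> ('ob, 'mb, 'eb, 'zb) extricat_scheme \<Rightarrow>
      ('oc, 'mc, 'ec, 'zc) extricat_scheme \<Rightarrow>
      ('ob, 'mb, 'oa, 'ma) functor_data \<Rightarrow> ('oa, 'ma, 'ob, 'mb) functor_data \<Rightarrow>
      ('ob, 'mb, 'oa, 'ma) functor_data \<Rightarrow>
      ('oc, 'mc, 'ob, 'mb) functor_data \<Rightarrow> ('ob, 'mb, 'oc, 'mc) functor_data \<Rightarrow>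
      ('oc, 'mc, 'ob, 'mb) functor_data \<Rightarrow> bool"
  where "recollement CA CB CC i_pull i_push i_shriek j_shriek j_pull j_push \<longleftrightarrow>
    exact_functor CA CB i_push \<and> exact_functor CB CC j_pull \<and>
    right_exact_functor CB CA i_pull \<and> right_exact_functor CC CB j_shriek \<and>
    left_exact_functor CB CA i_shriek \<and> left_exact_functor CC CB j_push \<and>
    ess_image CB i_push (Ob CA) = {X \<in> Ob CB. zero_object CC (FOb j_pull X)} \<and>
    fully_faithful CA CB i_push \<and> fully_faithful CC CB j_shriek \<and> fully_faithful CC CB j_push \<and>
    (\<exists>u1 v1 u2 v2 u3 v3 u4 v4.
      adjunction CB CA i_pull i_push u1 v1 \<and>
      adjunction CA CB i_push i_shriek u2 v2 \<and>
      adjunction CC CB j_shriek j_pull u3 v3 \<and>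
      adjunction CB CC j_pull j_push u4 v4 \<and>
      (\<forall>X \<in> Ob CB. \<exists>A \<in> Ob CA. \<exists>h.
        left_exact_etriangle_seq CB
          (FOb i_push (FOb i_shriek X)) (v2 X) X (u4 X) (FOb j_push (FOb j_pull X)) h
          (FOb i_push A)) \<and>
      (\<forall>X \<in> Ob CB. \<exists>A' \<in> Ob CA. \<exists>h.
        right_exact_etriangle_seq CB
          (FOb i_push A') h (FOb j_shriek (FOb j_pull X)) (v3 X) X (u1 X)
          (FOb i_push (FOb i_pull X))))"


section \<open>Balanced pairs\<close>

definition full_additive_subcategory :: "('o, 'm, 'z) precat_scheme \<Rightarrow> 'o set \<Rightarrow> bool"
  where "full_additive_subcategory C S \<longleftrightarrow> S \<subseteq> Ob C \<and> (\<exists>Z \<in> S. zero_object C Z) \<and>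
    (\<forall>A \<in> S. \<forall>B \<in> S. \<exists>P \<in> S. \<exists>i1 i2 p1 p2. biproduct C A B P i1 i2 p1 p2)"

definition closed_under_summands :: "('o, 'm, 'z) precat_scheme \<Rightarrow> 'o set \<Rightarrow> bool"
  where "closed_under_summands C S \<longleftrightarrow>
    (\<forall>P \<in> S. \<forall>A B i1 i2 p1 p2. biproduct C A B P i1 i2 p1 p2 \<longrightarrow> A \<in> S)"

type_synonym ('o, 'm, 'e) triangle = "'o \<times> 'm \<times> 'o \<times> 'm \<times> 'o \<times> 'e"

text \<open>
  \<open>cov_exact C W A f B g D\<close> is exactness of \<open>0 \<rightarrow> C(W, A) \<rightarrow> C(W, B) \<rightarrow> C(W, D) \<rightarrow> 0\<close>, and
  \<open>contra_exact C A f B g D W\<close> that of \<open>0 \<rightarrow> C(D, W) \<rightarrow> C(B, W) \<rightarrow> C(A, W) \<rightarrow> 0\<close>; the arguments of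
  \<^const>\<open>short_exact_sequence\<close> are listed from the last group to the first.
\<close>

definition cov_exact ::
    "('o, 'm, 'z) precat_scheme \<Rightarrow> 'o \<Rightarrow> 'o \<Rightarrow> 'm \<Rightarrow> 'o \<Rightarrow> 'm \<Rightarrow> 'o \<Rightarrow> bool"
  where "cov_exact C W A f B g D \<longleftrightarrow>
    short_exact_sequence (Hom C W D) (Hom C W B) (Hom C W A) (\<lambda>u. g \<cdot>\<^bsub>C\<^esub> u) (\<lambda>u. f \<cdot>\<^bsub>C\<^esub> u)"

definition contra_exact ::
    "('o, 'm, 'z) precat_scheme \<Rightarrow> 'o \<Rightarrow> 'm \<Rightarrow> 'o \<Rightarrow> 'm \<Rightarrow> 'o \<Rightarrow> 'o \<Rightarrow> bool"
  where "contra_exact C A f B g D W \<longleftrightarrow>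
    short_exact_sequence (Hom C A W) (Hom C B W) (Hom C D W) (\<lambda>u. u \<cdot>\<^bsub>C\<^esub> f) (\<lambda>u. u \<cdot>\<^bsub>C\<^esub> g)"

definition xi_lower :: "('o, 'm, 'e, 'z) extricat_scheme \<Rightarrow> 'o set \<Rightarrow> ('o, 'm, 'e) triangle set"
  where "xi_lower C XX = {(A, f, B, g, D, \<delta>). etriangle C A f B g D \<delta> \<and>
    (\<forall>X \<in> XX. cov_exact C X A f B g D)}"

definition xi_upper :: "('o, 'm, 'e, 'z) extricat_scheme \<Rightarrow> 'o set \<Rightarrow> ('o, 'm, 'e) triangle set"
  where "xi_upper C YY = {(A, f, B, g, D, \<delta>). etriangle C A f B g D \<delta> \<and>
    (\<forall>Y \<in> YY. contra_exact C A f B g D Y)}"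

definition proj_obs :: "('o, 'm, 'z) precat_scheme \<Rightarrow> ('o, 'm, 'e) triangle set \<Rightarrow> 'o set"
  where "proj_obs C \<xi> = {P \<in> Ob C. \<forall>(A, f, B, g, D, \<delta>) \<in> \<xi>. cov_exact C P A f B g D}"

definition inj_obs :: "('o, 'm, 'z) precat_scheme \<Rightarrow> ('o, 'm, 'e) triangle set \<Rightarrow> 'o set"
  where "inj_obs C \<xi> = {I \<in> Ob C. \<forall>(A, f, B, g, D, \<delta>) \<in> \<xi>. contra_exact C A f B g D I}"

definition enough_projectives ::
    "('o, 'm, 'z) precat_scheme \<Rightarrow> ('o, 'm, 'e) triangle set \<Rightarrow> bool"
  where "enough_projectives C \<xi> \<longleftrightarrow>
    (\<forall>A \<in> Ob C. \<exists>K f P g \<delta>. P \<in> proj_obs C \<xi> \<and> (K, f, P, g, A, \<delta>) \<in> \<xi>)"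

definition enough_injectives ::
    "('o, 'm, 'z) precat_scheme \<Rightarrow> ('o, 'm, 'e) triangle set \<Rightarrow> bool"
  where "enough_injectives C \<xi> \<longleftrightarrow>
    (\<forall>A \<in> Ob C. \<exists>f I g K \<delta>. I \<in> inj_obs C \<xi> \<and> (A, f, I, g, K, \<delta>) \<in> \<xi>)"

definition balanced_pair ::
    "('o, 'm, 'e, 'z) extricat_scheme \<Rightarrow> 'o set \<Rightarrow> 'o set \<Rightarrow> bool"
  where "balanced_pair C XX YY \<longleftrightarrow>
    full_additive_subcategory C XX \<and> closed_under_summands C XX \<and>
    full_additive_subcategory C YY \<and> closed_under_summands C YY \<and>
    xi_lower C XX = xi_upper C YY \<and>
    XX = proj_obs C (xi_lower C XX) \<and>
    YY = inj_obs C (xi_upper C YY) \<and>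
    enough_projectives C (xi_lower C XX) \<and>
    enough_injectives C (xi_upper C YY)"

end

theory Submission
  imports Defs
begin

text \<open>
Both parts are instances of one statement, \<open>balanced_pair_transfer\<close>. Let \<open>F, G : B \<rightarrow> D\<close> be exact
functors, let \<open>F\<close> have a right adjoint \<open>R\<close> and a functor \<open>L\<close> with \<open>F L \<cong> id\<close>, and let \<open>G\<close> have a left
adjoint \<open>L'\<close> and a functor \<open>R'\<close> with \<open>G R' \<cong> id\<close>. In part (1) take \<open>F = G = j\<^sup>*\<close>, \<open>L = L' = j\<^sub>!\<close>,
\<open>R = R' = j\<^sub>*\<close>; in part (2) take \<open>F = i\<^sup>*\<close>, \<open>G = i\<^sup>!\<close> and \<open>L = R = L' = R' = i\<^sub>*\<close>. The natural
isomorphisms are the invertible units and counits of adjunctions with a fully faithful side.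

Put \<open>S = F X\<close> and \<open>T = G Y\<close>. An object \<open>D\<close> has a relative projective cover of the right kind, because
\<open>L D\<close> has one in \<open>B\<close>, a triangle \<open>K \<rightarrow> X \<rightarrow> L D\<close> in \<open>\<xi>\<^sub>X\<close>: its image \<open>F K \<rightarrow> F X \<rightarrow> F L D \<cong> D\<close> is a
triangle. A map \<open>P \<rightarrow> D\<close> with \<open>P \<in> S\<close> lifts, since \<open>L P \<in> X\<close> lets \<open>L P \<rightarrow> L D\<close> lift to \<open>X\<close>, and \<open>F\<close>
carries this lift back. A map \<open>F K \<rightarrow> Q\<close> with \<open>Q \<in> T\<close> extends to \<open>F X\<close>, since by adjunction it is a map
\<open>K \<rightarrow> R Q\<close>, \<open>R Q \<in> Y\<close>, and the triangle is also in \<open>\<xi>\<^sup>Y = \<xi>\<^sub>X\<close>. This is \<open>approximation\<close>.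

Such covers force \<open>\<xi>\<^sub>S \<subseteq> \<xi>\<^sup>T\<close>. If \<open>A \<rightarrow> B \<rightarrow> D\<close> realizes \<open>\<delta>\<close> and every map from \<open>S\<close> to \<open>D\<close> lifts to \<open>B\<close>,
then \<open>\<delta> = a\<^sub>*\<epsilon>\<close> for the extension \<open>\<epsilon>\<close> of the cover \<open>K \<rightarrow> P \<rightarrow> D\<close>; for \<open>u : A \<rightarrow> Q\<close> the class
\<open>u\<^sub>*\<delta> = (u a)\<^sub>*\<epsilon>\<close> vanishes because \<open>u a : K \<rightarrow> Q\<close> extends to \<open>P\<close>, and \<open>u\<^sub>*\<delta> = 0\<close> says exactly that
\<open>u\<close> extends to \<open>B\<close>. The covers also give \<open>S = P(\<xi>\<^sub>S)\<close>: a relative projective is a retract of the middle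
term of its cover, and \<open>S\<close> is closed under retracts because \<open>L\<close> takes it into \<open>X = P(\<xi>\<^sub>X)\<close>.

The vanishing of the negative extensions enters only through the left end of the sequences that
define \<open>\<xi>\<^sub>S\<close> and \<open>\<xi>\<^sup>T\<close>: it makes \<open>D(P, A) \<rightarrow> D(P, B)\<close> and \<open>D(D, Q) \<rightarrow> D(B, Q)\<close> injective.

Everything so far is one half of the claim. The other half is the same statement for the opposite
categories, and the opposite of an extriangulated category is again extriangulated.
\<close>

section \<open>Preadditive categories\<close>

context preadditive_category
begin

lemma hom_group: "\<lbrakk>A \<in> Ob C; B \<in> Ob C\<rbrakk> \<Longrightarrow> group (Hom C A B)"
  using hom_comm_group comm_group.axioms(2) by blast

lemma zero_closed: "\<lbrakk>A \<in> Ob C; B \<in> Ob C\<rbrakk> \<Longrightarrow> \<one>\<^bsub>Hom C A B\<^esub> \<in> Mor C A B"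
  by (simp add: group.is_monoid hom_group)

lemma postcomp_hom:
  "\<lbrakk>W \<in> Ob C; A \<in> Ob C; B \<in> Ob C; f \<in> Mor C A B\<rbrakk> \<Longrightarrow> (\<lambda>u. f \<cdot> u) \<in> hom (Hom C W A) (Hom C W B)"
  by (rule homI) (auto intro: comp_closed comp_add_right)

lemma precomp_hom:
  "\<lbrakk>A \<in> Ob C; B \<in> Ob C; W \<in> Ob C; f \<in> Mor C A B\<rbrakk> \<Longrightarrow> (\<lambda>u. u \<cdot> f) \<in> hom (Hom C B W) (Hom C A W)"
  by (rule homI) (auto intro: comp_closed comp_add_left)

lemma comp_zero_right:
  "\<lbrakk>W \<in> Ob C; A \<in> Ob C; B \<in> Ob C; f \<in> Mor C A B\<rbrakk> \<Longrightarrow> f \<cdot> \<one>\<^bsub>Hom C W A\<^esub> = \<one>\<^bsub>Hom C W B\<^esub>"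
  using hom_one[OF postcomp_hom hom_group hom_group] by blast

lemma comp_zero_left:
  "\<lbrakk>A \<in> Ob C; B \<in> Ob C; W \<in> Ob C; f \<in> Mor C A B\<rbrakk> \<Longrightarrow> \<one>\<^bsub>Hom C B W\<^esub> \<cdot> f = \<one>\<^bsub>Hom C A W\<^esub>"
  using hom_one[OF precomp_hom hom_group hom_group] by blast

text \<open>
Differences turn the vanishing criterion for an epimorphism into a cancellation rule.
\<close>

lemma precomp_cancel:
  assumes "A \<in> Ob C" "B \<in> Ob C" "W \<in> Ob C" "f \<in> Mor C A B" "u \<in> Mor C B W" "v \<in> Mor C B W"
    and epi: "\<And>w. \<lbrakk>w \<in> Mor C B W; w \<cdot> f = \<one>\<^bsub>Hom C A W\<^esub>\<rbrakk> \<Longrightarrow> w = \<one>\<^bsub>Hom C B W\<^esub>"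
    and eq: "u \<cdot> f = v \<cdot> f"
  shows "u = v"
proof -
  interpret group_hom "Hom C B W" "Hom C A W" "\<lambda>u. u \<cdot> f"
    using assms by (simp add: group_hom_def group_hom_axioms_def hom_group precomp_hom)
  have "inj_on (\<lambda>u. u \<cdot> f) (Mor C B W)"
    using epi by (simp add: inj_on_one_iff)
  then show ?thesis using eq assms(5,6) by (rule inj_onD)
qed

lemma is_iso_inverse:
  assumes "is_iso C A B f"
  obtains g where "is_iso C B A g" "g \<cdot> f = Idn C A" "f \<cdot> g = Idn C B"
  using assms unfolding is_iso_def by blast

lemma is_iso_id: "A \<in> Ob C \<Longrightarrow> is_iso C A A (Idn C A)"
  unfolding is_iso_def by (metis id_closed id_left)

lemma is_iso_sym: "(\<exists>f. is_iso C A B f) \<longleftrightarrow> (\<exists>f. is_iso C B A f)"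
  unfolding is_iso_def by blast

lemma mem_ess_image: "\<lbrakk>X \<in> S; B \<in> Ob C; is_iso C (FOb F X) B f\<rbrakk> \<Longrightarrow> B \<in> ess_image C F S"
  unfolding ess_image_def by blast

lemma zero_object_from:
  assumes "zero_object C Z" "A \<in> Ob C" "f \<in> Mor C Z A"
  shows "f = \<one>\<^bsub>Hom C Z A\<^esub>"
  using assms unfolding zero_object_def by (metis comp_zero_right id_right)

lemma biproduct_sym:
  assumes "biproduct C A B P i1 i2 p1 p2"
  shows "biproduct C B A P i2 i1 p2 p1"
proof -
  have ob: "A \<in> Ob C" "B \<in> Ob C" "P \<in> Ob C" and m: "i1 \<in> Mor C A P" "p1 \<in> Mor C P A"
    "i2 \<in> Mor C B P" "p2 \<in> Mor C P B"
    using assms unfolding biproduct_def by auto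
  have "(i1 \<cdot> p1) \<otimes>\<^bsub>Hom C P P\<^esub> (i2 \<cdot> p2) = (i2 \<cdot> p2) \<otimes>\<^bsub>Hom C P P\<^esub> (i1 \<cdot> p1)"
    using ob m by (meson comm_groupE(4) comp_closed hom_comm_group)
  then show ?thesis using assms unfolding biproduct_def by simp
qed

text \<open>
An isomorphism exhibits its source as a biproduct with a zero object. This turns identities and
isomorphisms into inflations and deflations of split triangles.
\<close>

lemma biproduct_zero:
  assumes "zero_object C Z" "is_iso C P A \<phi>" "A \<in> Ob C" "P \<in> Ob C"
    and "\<psi> \<in> Mor C A P" "\<psi> \<cdot> \<phi> = Idn C P" "\<phi> \<cdot> \<psi> = Idn C A"
  shows "biproduct C A Z P \<psi> \<one>\<^bsub>Hom C Z P\<^esub> \<phi> \<one>\<^bsub>Hom C P Z\<^esub>"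
proof -
  have Z: "Z \<in> Ob C" "Idn C Z = \<one>\<^bsub>Hom C Z Z\<^esub>"
    using assms(1) unfolding zero_object_def by auto
  have \<phi>: "\<phi> \<in> Mor C P A" using assms(2) unfolding is_iso_def by simp
  have "Idn C P \<otimes>\<^bsub>Hom C P P\<^esub> \<one>\<^bsub>Hom C P P\<^esub> = Idn C P"
    using assms(4) by (simp add: id_closed hom_group group.is_monoid)
  then show ?thesis
    using assms Z \<phi> unfolding biproduct_def
    by (simp add: zero_closed comp_zero_left comp_zero_right)
qed

text \<open>
All arguments about the short exact sequences of Hom-groups chase elements, so that exactness is taken
apart once and for all.
\<close>

lemma cov_exact_iff:
  assumes "W \<in> Ob C" "A \<in> Ob C" "B \<in> Ob C" "D \<in> Ob C" "f \<in> Mor C A B" "g \<in> Mor C B D"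
  shows "cov_exact C W A f B g D \<longleftrightarrow>
    (\<forall>u \<in> Mor C W A. f \<cdot> u = \<one>\<^bsub>Hom C W B\<^esub> \<longrightarrow> u = \<one>\<^bsub>Hom C W A\<^esub>) \<and>
    (\<forall>u \<in> Mor C W A. g \<cdot> (f \<cdot> u) = \<one>\<^bsub>Hom C W D\<^esub>) \<and>
    (\<forall>u \<in> Mor C W B. g \<cdot> u = \<one>\<^bsub>Hom C W D\<^esub> \<longrightarrow> (\<exists>s \<in> Mor C W A. f \<cdot> s = u)) \<and>
    (\<forall>w \<in> Mor C W D. \<exists>u \<in> Mor C W B. g \<cdot> u = w)" (is "_ \<longleftrightarrow> ?inj \<and> ?zero \<and> ?ker \<and> ?surj")
proof -
  interpret f: group_hom "Hom C W A" "Hom C W B" "\<lambda>u. f \<cdot> u"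
    using assms by (simp add: group_hom_def group_hom_axioms_def hom_group postcomp_hom)
  interpret g: group_hom "Hom C W B" "Hom C W D" "\<lambda>u. g \<cdot> u"
    using assms by (simp add: group_hom_def group_hom_axioms_def hom_group postcomp_hom)
  have "cov_exact C W A f B g D \<longleftrightarrow>
      kernel (Hom C W B) (Hom C W D) (\<lambda>u. g \<cdot> u) = (\<lambda>u. f \<cdot> u) ` Mor C W A \<and>
      (\<lambda>u. g \<cdot> u) ` Mor C W B = Mor C W D \<and> inj_on (\<lambda>u. f \<cdot> u) (Mor C W A)"
    unfolding cov_exact_def short_exact_sequence_iff
    by (auto simp: epi_def mon_def f.group_hom_axioms g.group_hom_axioms f.homh g.homh)
  also have "inj_on (\<lambda>u. f \<cdot> u) (Mor C W A) \<longleftrightarrow> ?inj"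
    using f.inj_on_one_iff by blast
  also have "kernel (Hom C W B) (Hom C W D) (\<lambda>u. g \<cdot> u) = (\<lambda>u. f \<cdot> u) ` Mor C W A \<longleftrightarrow> ?zero \<and> ?ker"
  proof -
    have "(\<lambda>u. f \<cdot> u) ` Mor C W A \<subseteq> kernel (Hom C W B) (Hom C W D) (\<lambda>u. g \<cdot> u) \<longleftrightarrow> ?zero"
      unfolding kernel_def image_subset_iff mem_Collect_eq by simp
    moreover have "kernel (Hom C W B) (Hom C W D) (\<lambda>u. g \<cdot> u) \<subseteq> (\<lambda>u. f \<cdot> u) ` Mor C W A \<longleftrightarrow> ?ker"
      unfolding kernel_def subset_iff image_iff mem_Collect_eq by (metis (no_types))
    ultimately show ?thesis by (simp only: set_eq_subset conj_commute)
  qed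
  also have "(\<lambda>u. g \<cdot> u) ` Mor C W B = Mor C W D \<longleftrightarrow> ?surj"
  proof -
    have "(\<lambda>u. g \<cdot> u) ` Mor C W B \<subseteq> Mor C W D" by (simp add: image_subset_iff)
    moreover have "Mor C W D \<subseteq> (\<lambda>u. g \<cdot> u) ` Mor C W B \<longleftrightarrow> ?surj"
      unfolding subset_iff image_iff Ball_def by (metis (no_types))
    ultimately show ?thesis by (simp only: set_eq_subset simp_thms)
  qed
  finally show ?thesis by blast
qed

text \<open>
If \<open>W\<close> is a retract of \<open>P\<close>, the sequence of groups for \<open>W\<close> is a retract of the one for \<open>P\<close>: test maps
are carried to \<open>P\<close> along \<open>r\<close>, and the results are carried back along \<open>s\<close>.
\<close>

lemma cov_exact_retract:
  assumes ob: "P \<in> Ob C" "W \<in> Ob C" "A \<in> Ob C" "B \<in> Ob C" "D \<in> Ob C"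
    and f: "f \<in> Mor C A B" and g: "g \<in> Mor C B D"
    and s: "s \<in> Mor C W P" and r: "r \<in> Mor C P W" and rs: "r \<cdot> s = Idn C W"
    and P: "cov_exact C P A f B g D"
  shows "cov_exact C W A f B g D"
proof -
  have retr: "(u \<cdot> r) \<cdot> s = u" if "u \<in> Mor C W Y" "Y \<in> Ob C" for u Y
    using comp_assoc[OF ob(2,1,2) that(2) s r that(1)] rs id_right[OF ob(2) that(2,1)] by simp
  have ur: "u \<cdot> r \<in> Mor C P Y" if "u \<in> Mor C W Y" "Y \<in> Ob C" for u Y
    using comp_closed[OF ob(1,2) that(2) r that(1)] .
  note E = P[unfolded cov_exact_iff[OF ob(1,3-5) f g]]
  have "u = \<one>\<^bsub>Hom C W A\<^esub>" if u: "u \<in> Mor C W A" and fu: "f \<cdot> u = \<one>\<^bsub>Hom C W B\<^esub>" for u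
  proof -
    have "f \<cdot> (u \<cdot> r) = \<one>\<^bsub>Hom C P B\<^esub>"
      using comp_assoc[OF ob(1,2,3,4) r u f] fu comp_zero_left[OF ob(1,2,4) r] by simp
    then have "u \<cdot> r = \<one>\<^bsub>Hom C P A\<^esub>" using E ur[OF u ob(3)] by blast
    then show ?thesis using retr[OF u ob(3)] comp_zero_left[OF ob(2,1,3) s] by simp
  qed
  moreover have "g \<cdot> (f \<cdot> u) = \<one>\<^bsub>Hom C W D\<^esub>" if u: "u \<in> Mor C W A" for u
  proof -
    have fu: "f \<cdot> u \<in> Mor C W B" using comp_closed[OF ob(2,3,4) u f] .
    have gfu: "g \<cdot> (f \<cdot> u) \<in> Mor C W D" using comp_closed[OF ob(2,4,5) fu g] .
    have "(g \<cdot> (f \<cdot> u)) \<cdot> r = g \<cdot> (f \<cdot> (u \<cdot> r))"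
      using comp_assoc[OF ob(1,2,4,5) r fu g] comp_assoc[OF ob(1,2,3,4) r u f] by simp
    also have "\<dots> = \<one>\<^bsub>Hom C P D\<^esub>" using E ur[OF u ob(3)] by blast
    finally show ?thesis
      using retr[OF gfu ob(5)] comp_zero_left[OF ob(2,1,5) s] by simp
  qed
  moreover have "\<exists>t \<in> Mor C W A. f \<cdot> t = u" if u: "u \<in> Mor C W B" and gu: "g \<cdot> u = \<one>\<^bsub>Hom C W D\<^esub>" for u
  proof -
    have "g \<cdot> (u \<cdot> r) = \<one>\<^bsub>Hom C P D\<^esub>"
      using comp_assoc[OF ob(1,2,4,5) r u g] gu comp_zero_left[OF ob(1,2,5) r] by simp
    then obtain t where t: "t \<in> Mor C P A" "f \<cdot> t = u \<cdot> r" using E ur[OF u ob(4)] by blast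
    then have "f \<cdot> (t \<cdot> s) = u"
      using comp_assoc[OF ob(2,1,3,4) s t(1) f] retr[OF u ob(4)] by simp
    then show ?thesis using comp_closed[OF ob(2,1,3) s t(1)] by blast
  qed
  moreover have "\<exists>u \<in> Mor C W B. g \<cdot> u = w" if w: "w \<in> Mor C W D" for w
  proof -
    obtain t where t: "t \<in> Mor C P B" "g \<cdot> t = w \<cdot> r" using E ur[OF w ob(5)] by blast
    then have "g \<cdot> (t \<cdot> s) = w"
      using comp_assoc[OF ob(2,1,4,5) s t(1) g] retr[OF w ob(5)] by simp
    then show ?thesis using comp_closed[OF ob(2,1,4) s t(1)] by blast
  qed
  ultimately show ?thesis using cov_exact_iff[OF ob(2-5) f g] by blast
qed

lemma biproduct_maps_eqI:
  assumes bp: "biproduct C A B P i1 i2 p1 p2" and Y: "Y \<in> Ob C"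
    and u: "u \<in> Mor C P Y" and v: "v \<in> Mor C P Y"
    and 1: "u \<cdot> i1 = v \<cdot> i1" and 2: "u \<cdot> i2 = v \<cdot> i2"
  shows "u = v"
proof -
  have ob: "A \<in> Ob C" "B \<in> Ob C" "P \<in> Ob C" and m: "i1 \<in> Mor C A P" "i2 \<in> Mor C B P"
    "p1 \<in> Mor C P A" "p2 \<in> Mor C P B"
    and id: "(i1 \<cdot> p1) \<otimes>\<^bsub>Hom C P P\<^esub> (i2 \<cdot> p2) = Idn C P"
    using bp unfolding biproduct_def by auto
  have "w = (w \<cdot> i1 \<cdot> p1) \<otimes>\<^bsub>Hom C P Y\<^esub> (w \<cdot> i2 \<cdot> p2)" if w: "w \<in> Mor C P Y" for w
  proof -
    have "w = w \<cdot> ((i1 \<cdot> p1) \<otimes>\<^bsub>Hom C P P\<^esub> (i2 \<cdot> p2))"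
      using id id_right[OF ob(3) Y w] by simp
    also have "\<dots> = (w \<cdot> (i1 \<cdot> p1)) \<otimes>\<^bsub>Hom C P Y\<^esub> (w \<cdot> (i2 \<cdot> p2))"
      using comp_add_right[OF ob(3,3) Y _ _ w] comp_closed[OF ob(3,1,3) m(3,1)]
        comp_closed[OF ob(3,2,3) m(4,2)] by blast
    finally show ?thesis
      using comp_assoc[OF ob(3,1,3) Y m(3,1) w] comp_assoc[OF ob(3,2,3) Y m(4,2) w] by simp
  qed
  from this[OF u] this[OF v] show ?thesis using 1 2 by simp
qed

lemma biproduct_copair:
  assumes bp: "biproduct C A B P i1 i2 p1 p2" and Y: "Y \<in> Ob C"
    and a: "a \<in> Mor C A Y" and b: "b \<in> Mor C B Y"
  obtains u where "u \<in> Mor C P Y" "u \<cdot> i1 = a" "u \<cdot> i2 = b"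
proof
  have ob: "A \<in> Ob C" "B \<in> Ob C" "P \<in> Ob C" and m: "i1 \<in> Mor C A P" "i2 \<in> Mor C B P"
    "p1 \<in> Mor C P A" "p2 \<in> Mor C P B"
    and eq: "p1 \<cdot> i1 = Idn C A" "p2 \<cdot> i2 = Idn C B"
      "p1 \<cdot> i2 = \<one>\<^bsub>Hom C B A\<^esub>" "p2 \<cdot> i1 = \<one>\<^bsub>Hom C A B\<^esub>"
    using bp unfolding biproduct_def by auto
  interpret AY: group "Hom C A Y" using ob Y by (simp add: hom_group)
  interpret BY: group "Hom C B Y" using ob Y by (simp add: hom_group)
  interpret PY: group "Hom C P Y" using ob Y by (simp add: hom_group)
  let ?u = "(a \<cdot> p1) \<otimes>\<^bsub>Hom C P Y\<^esub> (b \<cdot> p2)"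
  have ap: "a \<cdot> p1 \<in> Mor C P Y" and bp: "b \<cdot> p2 \<in> Mor C P Y"
    using comp_closed[OF ob(3,1) Y m(3) a] comp_closed[OF ob(3,2) Y m(4) b] .
  then show "?u \<in> Mor C P Y" by simp
  have "?u \<cdot> i1 = (a \<cdot> p1 \<cdot> i1) \<otimes>\<^bsub>Hom C A Y\<^esub> (b \<cdot> p2 \<cdot> i1)"
    using comp_add_left[OF ob(1,3) Y m(1) ap bp] .
  also have "\<dots> = (a \<cdot> (p1 \<cdot> i1)) \<otimes>\<^bsub>Hom C A Y\<^esub> (b \<cdot> (p2 \<cdot> i1))"
    using comp_assoc[OF ob(1,3,1) Y m(1,3) a] comp_assoc[OF ob(1,3,2) Y m(1,4) b] by simp
  finally show "?u \<cdot> i1 = a"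
    using eq id_right[OF ob(1) Y a] comp_zero_right[OF ob(1,2) Y b] a by simp
  have "?u \<cdot> i2 = (a \<cdot> p1 \<cdot> i2) \<otimes>\<^bsub>Hom C B Y\<^esub> (b \<cdot> p2 \<cdot> i2)"
    using comp_add_left[OF ob(2,3) Y m(2) ap bp] .
  also have "\<dots> = (a \<cdot> (p1 \<cdot> i2)) \<otimes>\<^bsub>Hom C B Y\<^esub> (b \<cdot> (p2 \<cdot> i2))"
    using comp_assoc[OF ob(2,3,1) Y m(2,3) a] comp_assoc[OF ob(2,3,2) Y m(2,4) b] by simp
  finally show "?u \<cdot> i2 = b"
    using eq id_right[OF ob(2) Y b] comp_zero_right[OF ob(2,1) Y a] b by simp
qed

text \<open>
Together with the closure under retracts, exactness for zero objects and for biproducts makes the relative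
projectives of any class of triangles an additive subcategory closed under direct summands.
\<close>

lemma cov_exact_zero_object:
  assumes Z: "zero_object C Z" and ob: "A \<in> Ob C" "B \<in> Ob C" "D \<in> Ob C"
    and f: "f \<in> Mor C A B" and g: "g \<in> Mor C B D"
  shows "cov_exact C Z A f B g D"
proof -
  have Zo: "Z \<in> Ob C" using Z unfolding zero_object_def by simp
  have zero: "u = \<one>\<^bsub>Hom C Z Y\<^esub>" if "u \<in> Mor C Z Y" "Y \<in> Ob C" for u Y
    using zero_object_from[OF Z that(2,1)] .
  show ?thesis
    unfolding cov_exact_iff[OF Zo ob f g]
  proof (intro conjI ballI impI)
    fix u assume u: "u \<in> Mor C Z A"
    show "u = \<one>\<^bsub>Hom C Z A\<^esub>" using zero[OF u ob(1)] .
    show "g \<cdot> (f \<cdot> u) = \<one>\<^bsub>Hom C Z D\<^esub>"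
      by (rule zero[OF comp_closed[OF Zo ob(2,3) comp_closed[OF Zo ob(1,2) u f] g] ob(3)])
  next
    fix u assume u: "u \<in> Mor C Z B"
    have "f \<cdot> \<one>\<^bsub>Hom C Z A\<^esub> = u" using zero[OF u ob(2)] comp_zero_right[OF Zo ob(1,2) f] by simp
    then show "\<exists>s \<in> Mor C Z A. f \<cdot> s = u" using zero_closed[OF Zo ob(1)] by blast
  next
    fix w assume w: "w \<in> Mor C Z D"
    have "g \<cdot> \<one>\<^bsub>Hom C Z B\<^esub> = w" using zero[OF w ob(3)] comp_zero_right[OF Zo ob(2,3) g] by simp
    then show "\<exists>u \<in> Mor C Z B. g \<cdot> u = w" using zero_closed[OF Zo ob(2)] by blast
  qed
qed

lemma cov_exact_biproduct:
  assumes bp: "biproduct C P Q S i1 i2 p1 p2" and ob: "A \<in> Ob C" "B \<in> Ob C" "D \<in> Ob C"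
    and f: "f \<in> Mor C A B" and g: "g \<in> Mor C B D"
    and P: "cov_exact C P A f B g D" and Q: "cov_exact C Q A f B g D"
  shows "cov_exact C S A f B g D"
proof -
  have ob': "P \<in> Ob C" "Q \<in> Ob C" "S \<in> Ob C" and i: "i1 \<in> Mor C P S" "i2 \<in> Mor C Q S"
    using bp unfolding biproduct_def by auto
  note EP = P[unfolded cov_exact_iff[OF ob'(1) ob f g]]
  note EQ = Q[unfolded cov_exact_iff[OF ob'(2) ob f g]]
  have r: "u \<cdot> i1 \<in> Mor C P Y" "u \<cdot> i2 \<in> Mor C Q Y" if "u \<in> Mor C S Y" "Y \<in> Ob C" for u Y
    using comp_closed[OF ob'(1,3) that(2) i(1) that(1)]
      comp_closed[OF ob'(2,3) that(2) i(2) that(1)] by simp_all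
  have a: "h \<cdot> u \<cdot> i1 = h \<cdot> (u \<cdot> i1)" "h \<cdot> u \<cdot> i2 = h \<cdot> (u \<cdot> i2)"
    if "u \<in> Mor C S Y" "h \<in> Mor C Y Y'" "Y \<in> Ob C" "Y' \<in> Ob C" for h u Y Y'
    using comp_assoc[OF ob'(1,3) that(3,4) i(1) that(1,2)]
      comp_assoc[OF ob'(2,3) that(3,4) i(2) that(1,2)] by simp_all
  have z: "\<one>\<^bsub>Hom C S Y\<^esub> \<cdot> i1 = \<one>\<^bsub>Hom C P Y\<^esub>" "\<one>\<^bsub>Hom C S Y\<^esub> \<cdot> i2 = \<one>\<^bsub>Hom C Q Y\<^esub>"
    "\<one>\<^bsub>Hom C S Y\<^esub> \<in> Mor C S Y" if "Y \<in> Ob C" for Y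
    using comp_zero_left[OF ob'(1,3) that i(1)] comp_zero_left[OF ob'(2,3) that i(2)]
      zero_closed[OF ob'(3) that] by simp_all
  have fc: "f \<cdot> u \<in> Mor C S B" if "u \<in> Mor C S A" for u
    using comp_closed[OF ob'(3) ob(1,2) that f] .
  have gc: "g \<cdot> u \<in> Mor C S D" if "u \<in> Mor C S B" for u
    using comp_closed[OF ob'(3) ob(2,3) that g] .
  note eqI = biproduct_maps_eqI[OF bp]
  have "u = \<one>\<^bsub>Hom C S A\<^esub>" if u: "u \<in> Mor C S A" and fu: "f \<cdot> u = \<one>\<^bsub>Hom C S B\<^esub>" for u
  proof -
    have "f \<cdot> (u \<cdot> i1) = \<one>\<^bsub>Hom C P B\<^esub>" "f \<cdot> (u \<cdot> i2) = \<one>\<^bsub>Hom C Q B\<^esub>"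
      using a[OF u f ob(1,2)] fu z[OF ob(2)] by simp_all
    then have "u \<cdot> i1 = \<one>\<^bsub>Hom C P A\<^esub>" "u \<cdot> i2 = \<one>\<^bsub>Hom C Q A\<^esub>"
      using EP EQ r[OF u ob(1)] by blast+
    then show ?thesis using eqI[OF ob(1) u] z[OF ob(1)] by simp
  qed
  moreover have "g \<cdot> (f \<cdot> u) = \<one>\<^bsub>Hom C S D\<^esub>" if u: "u \<in> Mor C S A" for u
  proof (rule eqI[OF ob(3) gc[OF fc[OF u]]])
    show "g \<cdot> (f \<cdot> u) \<cdot> i1 = \<one>\<^bsub>Hom C S D\<^esub> \<cdot> i1" "g \<cdot> (f \<cdot> u) \<cdot> i2 = \<one>\<^bsub>Hom C S D\<^esub> \<cdot> i2"
      using a[OF fc[OF u] g ob(2,3)] a[OF u f ob(1,2)] EP EQ r[OF u ob(1)] z[OF ob(3)] by simp_all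
  qed (use z[OF ob(3)] in simp)
  moreover have "\<exists>t \<in> Mor C S A. f \<cdot> t = u" if u: "u \<in> Mor C S B" and gu: "g \<cdot> u = \<one>\<^bsub>Hom C S D\<^esub>" for u
  proof -
    have "g \<cdot> (u \<cdot> i1) = \<one>\<^bsub>Hom C P D\<^esub>" "g \<cdot> (u \<cdot> i2) = \<one>\<^bsub>Hom C Q D\<^esub>"
      using a[OF u g ob(2,3)] gu z[OF ob(3)] by simp_all
    then obtain s t where s: "s \<in> Mor C P A" "f \<cdot> s = u \<cdot> i1" and t: "t \<in> Mor C Q A" "f \<cdot> t = u \<cdot> i2"
      using EP EQ r[OF u ob(2)] by meson
    obtain v where v: "v \<in> Mor C S A" "v \<cdot> i1 = s" "v \<cdot> i2 = t"
      using biproduct_copair[OF bp ob(1) s(1) t(1)] .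
    have "f \<cdot> v = u"
      by (rule eqI[OF ob(2) fc[OF v(1)] u]) (use a[OF v(1) f ob(1,2)] v s t in simp_all)
    then show ?thesis using v(1) by blast
  qed
  moreover have "\<exists>u \<in> Mor C S B. g \<cdot> u = w" if w: "w \<in> Mor C S D" for w
  proof -
    obtain s t where s: "s \<in> Mor C P B" "g \<cdot> s = w \<cdot> i1" and t: "t \<in> Mor C Q B" "g \<cdot> t = w \<cdot> i2"
      using EP EQ r[OF w ob(3)] by meson
    obtain v where v: "v \<in> Mor C S B" "v \<cdot> i1 = s" "v \<cdot> i2 = t"
      using biproduct_copair[OF bp ob(2) s(1) t(1)] .
    have "g \<cdot> v = w"
      by (rule eqI[OF ob(3) gc[OF v(1)] w]) (use a[OF v(1) g ob(2,3)] v s t in simp_all)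
    then show ?thesis using v(1) by blast
  qed
  ultimately show ?thesis using cov_exact_iff[OF ob'(3) ob f g] by blast
qed

end

section \<open>Extriangulated categories\<close>

lemma proj_obs_iff:
  "P \<in> proj_obs C \<xi> \<longleftrightarrow>
    P \<in> Ob C \<and> (\<forall>A f B g D \<delta>. (A, f, B, g, D, \<delta>) \<in> \<xi> \<longrightarrow> cov_exact C P A f B g D)"
  by (simp add: proj_obs_def Ball_def)

lemma proj_obsD:
  assumes "P \<in> proj_obs C \<xi>" "(A, f, B, g, D, \<delta>) \<in> \<xi>"
  shows "P \<in> Ob C" "cov_exact C P A f B g D"
  using assms by (auto simp: proj_obs_def dest!: bspec)

context extriangulated_category
begin

lemma etriangle_data:
  assumes "etriangle C A x B y D \<delta>"
  shows "A \<in> Ob C" "B \<in> Ob C" "D \<in> Ob C" "x \<in> Mor C A B" "y \<in> Mor C B D" "\<delta> \<in> Exts C D A"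
  using assms unfolding etriangle_def by auto

lemma bmap_hom:
  "\<lbrakk>D \<in> Ob C; D' \<in> Ob C; A \<in> Ob C; A' \<in> Ob C; c \<in> Mor C D' D; a \<in> Mor C A A'\<rbrakk>
    \<Longrightarrow> BMap (Ext C) c a \<in> hom (BOb (Ext C) D A) (BOb (Ext C) D' A')"
  by (rule ext_bifunctor[unfolded additive_bifunctor_def, THEN conjunct2, THEN conjunct1, rule_format])

lemma ext_group: "\<lbrakk>D \<in> Ob C; A \<in> Ob C\<rbrakk> \<Longrightarrow> group (BOb (Ext C) D A)"
  by (rule comm_group.axioms(2)) (rule ext_bifunctor[unfolded additive_bifunctor_def, THEN conjunct1, rule_format])

lemma bmap_comp:
  "\<lbrakk>D \<in> Ob C; D' \<in> Ob C; D'' \<in> Ob C; A \<in> Ob C; A' \<in> Ob C; A'' \<in> Ob C;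
    c \<in> Mor C D' D; c' \<in> Mor C D'' D'; a \<in> Mor C A A'; a' \<in> Mor C A' A''; \<delta> \<in> Exts C D A\<rbrakk>
    \<Longrightarrow> BMap (Ext C) (c \<cdot> c') (a' \<cdot> a) \<delta> = BMap (Ext C) c' a' (BMap (Ext C) c a \<delta>)"
  by (rule ext_bifunctor[unfolded additive_bifunctor_def, THEN conjunct2, THEN conjunct2,
        THEN conjunct2, THEN conjunct1, rule_format])

lemma push_comp:
  assumes "D \<in> Ob C" "A \<in> Ob C" "A' \<in> Ob C" "A'' \<in> Ob C"
    and "a \<in> Mor C A A'" "a' \<in> Mor C A' A''" "\<delta> \<in> Exts C D A"
  shows "push C D (a' \<cdot> a) \<delta> = push C D a' (push C D a \<delta>)"
  using bmap_comp[OF assms(1,1,1-4) id_closed[OF assms(1)] id_closed[OF assms(1)] assms(5-7)]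
    id_left[OF assms(1,1) id_closed[OF assms(1)]]
  unfolding push_def by simp

lemma pull_id: "\<lbrakk>D \<in> Ob C; A \<in> Ob C; \<delta> \<in> Exts C D A\<rbrakk> \<Longrightarrow> pull C A (Idn C D) \<delta> = \<delta>"
  unfolding pull_def by (rule ext_bifunctor[unfolded additive_bifunctor_def, THEN conjunct2, THEN conjunct2, THEN conjunct1, rule_format])

lemma pull_zero_ext:
  assumes "D \<in> Ob C" "D' \<in> Ob C" "A \<in> Ob C" "c \<in> Mor C D' D"
  shows "pull C A c \<one>\<^bsub>BOb (Ext C) D A\<^esub> = \<one>\<^bsub>BOb (Ext C) D' A\<^esub>"
  unfolding pull_def
  using hom_one[OF bmap_hom[OF assms(1,2,3,3,4) id_closed]] ext_group assms by blast

text \<open>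
The triangles \<open>A = A \<rightarrow> 0\<close> and \<open>0 \<rightarrow> P \<cong> A\<close> are the test objects from which the exactness of the
Hom-sequences is read off: the axioms on morphisms of triangles, applied to one of them and a given
triangle, produce the required lifts and extensions.
\<close>

lemma split_etriangle_left:
  assumes Z: "zero_object C Z" and A: "A \<in> Ob C"
  shows "etriangle C A (Idn C A) A \<one>\<^bsub>Hom C A Z\<^esub> Z \<one>\<^bsub>BOb (Ext C) Z A\<^esub>"
  using realization_zero[OF biproduct_zero[OF Z is_iso_id[OF A] A A id_closed[OF A]]]
    id_left[OF A A id_closed[OF A]] by simp

lemma iso_etriangle:
  assumes Z: "zero_object C Z" and ob: "A \<in> Ob C" "P \<in> Ob C" and \<phi>: "is_iso C P A \<phi>"
  shows "etriangle C Z \<one>\<^bsub>Hom C Z P\<^esub> P \<phi> A \<one>\<^bsub>BOb (Ext C) A Z\<^esub>"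
proof -
  obtain \<psi> where "\<psi> \<in> Mor C A P" "\<psi> \<cdot> \<phi> = Idn C P" "\<phi> \<cdot> \<psi> = Idn C A"
    using \<phi> unfolding is_iso_def by blast
  from biproduct_zero[OF Z \<phi> ob this] show ?thesis
    using realization_zero biproduct_sym by blast
qed

lemma etriangle_comp_zero:
  assumes T: "etriangle C A x B y D \<delta>"
  shows "y \<cdot> x = \<one>\<^bsub>Hom C A D\<^esub>"
proof -
  obtain Z where Z: "zero_object C Z" using ex_zero_object by blast
  note d = etriangle_data[OF T]
  have Zo: "Z \<in> Ob C" using Z unfolding zero_object_def by simp
  obtain c where "c \<in> Mor C Z D" "c \<cdot> \<one>\<^bsub>Hom C A Z\<^esub> = y \<cdot> x"
    using ET3[OF split_etriangle_left[OF Z d(1)] T id_closed[OF d(1)] d(4)] by blast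
  then show ?thesis using comp_zero_right[OF d(1) Zo d(3)] by simp
qed

lemma inflation_weak_kernel:
  assumes T: "etriangle C A x B y D \<delta>" and W: "W \<in> Ob C" and u: "u \<in> Mor C W B"
    and yu: "y \<cdot> u = \<one>\<^bsub>Hom C W D\<^esub>"
  shows "\<exists>s \<in> Mor C W A. x \<cdot> s = u"
proof -
  obtain Z where Z: "zero_object C Z" using ex_zero_object by blast
  note d = etriangle_data[OF T]
  have Zo: "Z \<in> Ob C" using Z unfolding zero_object_def by simp
  have "\<one>\<^bsub>Hom C Z D\<^esub> \<cdot> \<one>\<^bsub>Hom C W Z\<^esub> = y \<cdot> u"
    using yu comp_zero_right[OF W Zo d(3) zero_closed[OF Zo d(3)]] by simp
  then obtain s where "s \<in> Mor C W A" "u \<cdot> Idn C W = x \<cdot> s"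
    using ET3_op[OF split_etriangle_left[OF Z W] T u zero_closed[OF Zo d(3)]] by blast
  then show ?thesis using id_right[OF W d(2) u] by metis
qed

text \<open>
Exactness of \<open>C(B, Q) \<rightarrow> C(A, Q) \<rightarrow> E(D, Q)\<close>. The map \<open>u\<close> extends along \<open>x\<close> precisely when there is a
morphism from the given triangle to the split triangle \<open>Q = Q \<rightarrow> 0\<close> that has \<open>u\<close> as its first
component.
\<close>

lemma push_zero_iff_extends:
  assumes T: "etriangle C A x B y D \<delta>" and Q: "Q \<in> Ob C" and u: "u \<in> Mor C A Q"
  shows "push C D u \<delta> = \<one>\<^bsub>BOb (Ext C) D Q\<^esub> \<longleftrightarrow> (\<exists>v \<in> Mor C B Q. v \<cdot> x = u)"
proof
  obtain Z where Z: "zero_object C Z" using ex_zero_object by blast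
  note d = etriangle_data[OF T]
  have Zo: "Z \<in> Ob C" using Z unfolding zero_object_def by simp
  have pz: "pull C Q c \<one>\<^bsub>BOb (Ext C) Z Q\<^esub> = \<one>\<^bsub>BOb (Ext C) D Q\<^esub>" if "c \<in> Mor C D Z" for c
    using pull_zero_ext[OF Zo d(3) Q that] .
  note S = split_etriangle_left[OF Z Q]
  show "\<exists>v \<in> Mor C B Q. v \<cdot> x = u" if "push C D u \<delta> = \<one>\<^bsub>BOb (Ext C) D Q\<^esub>"
    using realization_morphism[OF T S u zero_closed[OF d(3) Zo]] that
      pz[OF zero_closed[OF d(3) Zo]] id_left[OF d(1) Q u] by auto
  assume "\<exists>v \<in> Mor C B Q. v \<cdot> x = u"
  then obtain v where v: "v \<in> Mor C B Q" "v \<cdot> x = Idn C Q \<cdot> u"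
    using id_left[OF d(1) Q u] by auto
  from ET3[OF T S u v] pz show "push C D u \<delta> = \<one>\<^bsub>BOb (Ext C) D Q\<^esub>" by auto
qed

text \<open>
A triangle can be made to end at any object isomorphic to its end. The composite of its deflation with
the isomorphism is again a deflation by the octahedral axiom, which also provides a triangle
\<open>A \<rightarrow> E \<rightarrow> 0\<close> between the old and the new fibre. Its first map \<open>d\<close> can be cancelled, which is
what is needed to compare extension problems on \<open>A\<close> and on \<open>E\<close>.
\<close>

lemma etriangle_replace_end:
  assumes T: "etriangle C A x B y D \<delta>" and D': "D' \<in> Ob C" and \<phi>: "is_iso C D D' \<phi>"
  obtains E h \<delta>' d where "etriangle C E h B (\<phi> \<cdot> y) D' \<delta>'" "d \<in> Mor C A E" "h \<cdot> d = x"
    "\<And>Q w w'. \<lbrakk>Q \<in> Ob C; w \<in> Mor C E Q; w' \<in> Mor C E Q; w \<cdot> d = w' \<cdot> d\<rbrakk> \<Longrightarrow> w = w'"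
proof -
  obtain Z where Z: "zero_object C Z" using ex_zero_object by blast
  have Zo: "Z \<in> Ob C" using Z unfolding zero_object_def by simp
  note t = etriangle_data[OF T]
  obtain E h d e \<delta>' \<delta>'' where E: "etriangle C E h B (\<phi> \<cdot> y) D' \<delta>'" "etriangle C A d E e Z \<delta>''"
    "h \<cdot> d = x"
    using ET4_op[OF T iso_etriangle[OF Z D' t(3) \<phi>]] by blast
  note e = etriangle_data[OF E(2)]
  have "w = \<one>\<^bsub>Hom C E Q\<^esub>"
    if Q: "Q \<in> Ob C" and w: "w \<in> Mor C E Q" and wd: "w \<cdot> d = \<one>\<^bsub>Hom C A Q\<^esub>" for Q w
  proof -
    have "w \<cdot> d = \<one>\<^bsub>Hom C Z Q\<^esub> \<cdot> \<one>\<^bsub>Hom C A Z\<^esub>"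
      using wd comp_zero_right[OF e(1) Zo Q zero_closed[OF Zo Q]] by simp
    then obtain c where c: "c \<in> Mor C Z Q" "c \<cdot> e = Idn C Q \<cdot> w"
      using ET3[OF E(2) iso_etriangle[OF Z Q Q is_iso_id[OF Q]] zero_closed[OF e(1) Zo] w] by blast
    then have "w = \<one>\<^bsub>Hom C Z Q\<^esub> \<cdot> e"
      using zero_object_from[OF Z Q c(1)] id_left[OF e(2) Q w] by simp
    then show ?thesis using comp_zero_left[OF e(2) Zo Q e(5)] by simp
  qed
  then show thesis
    using that[OF E(1) e(4) E(3)] precomp_cancel[OF e(1,2) _ e(4)] by blast
qed

text \<open>
For a triangle the middle part of the sequence is always exact, so that only the two ends remain to
be checked.
\<close>

lemma cov_exact_etriangle_iff:
  assumes T: "etriangle C A f B g D \<delta>" and W: "W \<in> Ob C"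
  shows "cov_exact C W A f B g D \<longleftrightarrow>
    (\<forall>u \<in> Mor C W A. f \<cdot> u = \<one>\<^bsub>Hom C W B\<^esub> \<longrightarrow> u = \<one>\<^bsub>Hom C W A\<^esub>) \<and>
    (\<forall>w \<in> Mor C W D. \<exists>u \<in> Mor C W B. g \<cdot> u = w)"
proof -
  note d = etriangle_data[OF T]
  have "g \<cdot> (f \<cdot> u) = \<one>\<^bsub>Hom C W D\<^esub>" if u: "u \<in> Mor C W A" for u
    using comp_assoc[OF W d(1-3) u d(4,5)] etriangle_comp_zero[OF T] comp_zero_left[OF W d(1,3) u]
    by simp
  moreover have "\<exists>s \<in> Mor C W A. f \<cdot> s = u" if "u \<in> Mor C W B" "g \<cdot> u = \<one>\<^bsub>Hom C W D\<^esub>" for u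
    using inflation_weak_kernel[OF T W that] .
  ultimately show ?thesis unfolding cov_exact_iff[OF W d(1-5)] by simp
qed

lemma xi_lower_etriangle: "(A, f, B, g, D, \<delta>) \<in> xi_lower C S \<Longrightarrow> etriangle C A f B g D \<delta>"
  unfolding xi_lower_def by simp

lemma proj_obs_retract:
  assumes P: "P \<in> proj_obs C (xi_lower C S)" and W: "W \<in> Ob C"
    and s: "s \<in> Mor C W P" and r: "r \<in> Mor C P W" and rs: "r \<cdot> s = Idn C W"
  shows "W \<in> proj_obs C (xi_lower C S)"
  unfolding proj_obs_iff
proof (intro conjI allI impI)
  fix A f B g D \<delta> assume T: "(A, f, B, g, D, \<delta>) \<in> xi_lower C S"
  have Po: "P \<in> Ob C" and E: "cov_exact C P A f B g D"
    using proj_obsD[OF P T] .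
  show "cov_exact C W A f B g D"
    by (rule cov_exact_retract[OF Po W etriangle_data(1-5)[OF xi_lower_etriangle[OF T]] s r rs E])
qed (rule W)

lemma proj_obs_full_additive: "full_additive_subcategory C (proj_obs C (xi_lower C S))"
  unfolding full_additive_subcategory_def
proof (intro conjI ballI)
  show "proj_obs C (xi_lower C S) \<subseteq> Ob C" by (simp add: proj_obs_def)
  obtain Z where Z: "zero_object C Z" using ex_zero_object by blast
  have "Z \<in> proj_obs C (xi_lower C S)"
    unfolding proj_obs_iff
  proof (intro conjI allI impI)
    show "Z \<in> Ob C" using Z unfolding zero_object_def by simp
    fix A f B g D \<delta> assume T: "(A, f, B, g, D, \<delta>) \<in> xi_lower C S"
    show "cov_exact C Z A f B g D"
      by (rule cov_exact_zero_object[OF Z etriangle_data(1-5)[OF xi_lower_etriangle[OF T]]])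
  qed
  then show "\<exists>Z \<in> proj_obs C (xi_lower C S). zero_object C Z" using Z by blast
next
  fix P Q assume P: "P \<in> proj_obs C (xi_lower C S)" and Q: "Q \<in> proj_obs C (xi_lower C S)"
  then obtain U i1 i2 p1 p2 where bp: "biproduct C P Q U i1 i2 p1 p2"
    using ex_biproduct[of P Q] unfolding proj_obs_iff by blast
  have "U \<in> proj_obs C (xi_lower C S)"
    unfolding proj_obs_iff
  proof (intro conjI allI impI)
    show "U \<in> Ob C" using bp unfolding biproduct_def by simp
    fix A f B g D \<delta> assume T: "(A, f, B, g, D, \<delta>) \<in> xi_lower C S"
    have "cov_exact C P A f B g D" "cov_exact C Q A f B g D"
      using proj_obsD[OF P T] proj_obsD[OF Q T] by simp_all
    then show "cov_exact C U A f B g D"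
      by (rule cov_exact_biproduct[OF bp etriangle_data(1-5)[OF xi_lower_etriangle[OF T]]])
  qed
  then show "\<exists>U \<in> proj_obs C (xi_lower C S). \<exists>i1 i2 p1 p2. biproduct C P Q U i1 i2 p1 p2"
    using bp by blast
qed

lemma proj_obs_closed_under_summands: "closed_under_summands C (proj_obs C (xi_lower C S))"
  unfolding closed_under_summands_def
proof (intro ballI allI impI)
  fix P A B i1 i2 p1 p2
  assume P: "P \<in> proj_obs C (xi_lower C S)" and bp: "biproduct C A B P i1 i2 p1 p2"
  then show "A \<in> proj_obs C (xi_lower C S)"
    using proj_obs_retract[OF P, of A i1 p1] unfolding biproduct_def by simp
qed

end

section \<open>Opposite categories\<close>

text \<open>
Reversing arrows exchanges the two arguments of the bifunctor and the two maps of a realizing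
sequence. The passage to opposites exchanges the two halves of the notion of a balanced pair.
\<close>

definition op_cat :: "('o, 'm, 'e, 'z) extricat_scheme \<Rightarrow> ('o, 'm, 'e) extricat"
  where "op_cat C = \<lparr>Ob = Ob C, Hom = (\<lambda>A B. Hom C B A), Idn = Idn C, Cmp = (\<lambda>g f. f \<cdot>\<^bsub>C\<^esub> g),
    Ext = \<lparr>BOb = (\<lambda>D A. BOb (Ext C) A D), BMap = (\<lambda>c a. BMap (Ext C) a c)\<rparr>,
    Rlz = (\<lambda>D A \<delta>. prod.swap ` Rlz C A D \<delta>)\<rparr>"

lemma op_cat_simps [simp]:
  "Ob (op_cat C) = Ob C" "Hom (op_cat C) A B = Hom C B A" "Idn (op_cat C) = Idn C"
  "g \<cdot>\<^bsub>op_cat C\<^esub> f = f \<cdot>\<^bsub>C\<^esub> g" "BOb (Ext (op_cat C)) D A = BOb (Ext C) A D"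
  "BMap (Ext (op_cat C)) c a = BMap (Ext C) a c" "Rlz (op_cat C) D A \<delta> = prod.swap ` Rlz C A D \<delta>"
  by (simp_all add: op_cat_def)

lemma swap_image_iff: "(x, y) \<in> prod.swap ` R \<longleftrightarrow> (y, x) \<in> R"
  by force

lemma etriangle_op [simp]: "etriangle (op_cat C) A x B y D \<delta> \<longleftrightarrow> etriangle C D y B x A \<delta>"
  unfolding etriangle_def by (auto simp: swap_image_iff)

lemma push_op [simp]: "push (op_cat C) D a \<delta> = pull C D a \<delta>"
  and pull_op [simp]: "pull (op_cat C) A c \<delta> = push C A c \<delta>"
  by (simp_all add: push_def pull_def)

lemma is_iso_op [simp]: "is_iso (op_cat C) A B f \<longleftrightarrow> is_iso C B A f"
  unfolding is_iso_def by auto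

lemma zero_object_op [simp]: "zero_object (op_cat C) Z \<longleftrightarrow> zero_object C Z"
  by (simp add: zero_object_def)

lemma biproduct_op [simp]:
  "biproduct (op_cat C) A B P i1 i2 p1 p2 \<longleftrightarrow> biproduct C A B P p1 p2 i1 i2"
  unfolding biproduct_def by auto

lemma full_additive_subcategory_op [simp]:
  "full_additive_subcategory (op_cat C) S \<longleftrightarrow> full_additive_subcategory C S"
  unfolding full_additive_subcategory_def op_cat_simps zero_object_op biproduct_op by meson

lemma closed_under_summands_op [simp]:
  "closed_under_summands (op_cat C) S \<longleftrightarrow> closed_under_summands C S"
  unfolding closed_under_summands_def biproduct_op by meson

lemma cov_exact_op [simp]: "cov_exact (op_cat C) W D g B f A \<longleftrightarrow> contra_exact C A f B g D W"
  by (simp add: cov_exact_def contra_exact_def)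

lemma contra_exact_op [simp]: "contra_exact (op_cat C) D g B f A W \<longleftrightarrow> cov_exact C W A f B g D"
  by (simp add: cov_exact_def contra_exact_def)

lemma xi_lower_op [simp]: "(D, g, B, f, A, \<delta>) \<in> xi_lower (op_cat C) S \<longleftrightarrow>
    (A, f, B, g, D, \<delta>) \<in> xi_upper C S"
  and xi_upper_op [simp]: "(D, g, B, f, A, \<delta>) \<in> xi_upper (op_cat C) S \<longleftrightarrow> (A, f, B, g, D, \<delta>) \<in> xi_lower C S"
  by (simp_all add: xi_lower_def xi_upper_def)

lemma inj_obs_iff:
  "I \<in> inj_obs C \<xi> \<longleftrightarrow>
    I \<in> Ob C \<and> (\<forall>A f B g D \<delta>. (A, f, B, g, D, \<delta>) \<in> \<xi> \<longrightarrow> contra_exact C A f B g D I)"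
  by (simp add: inj_obs_def Ball_def)

lemma proj_obs_op: "proj_obs (op_cat C) (xi_lower (op_cat C) S) = inj_obs C (xi_upper C S)"
  unfolding set_eq_iff proj_obs_iff inj_obs_iff xi_lower_op cov_exact_op op_cat_simps by meson

lemma enough_projectives_op:
  "enough_projectives (op_cat C) (xi_lower (op_cat C) S) \<longleftrightarrow> enough_injectives C (xi_upper C S)"
  unfolding enough_projectives_def enough_injectives_def proj_obs_op xi_lower_op op_cat_simps by meson

context extriangulated_category
begin

lemma ess_image_op: "ess_image (op_cat C) F S = ess_image C F S"
  unfolding ess_image_def is_iso_op op_cat_simps using is_iso_sym by simp

lemma op_additive: "additive_category (op_cat C)"
proof (intro additive_category.intro preadditive_category.intro additive_category_axioms.intro,
    unfold biproduct_op zero_object_op op_cat_simps)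
  show "\<exists>Z. zero_object C Z" by (rule ex_zero_object)
  show "\<exists>P i1 i2 p1 p2. biproduct C A B P p1 p2 i1 i2" if "A \<in> Ob C" "B \<in> Ob C" for A B
    using ex_biproduct[OF that] by meson
  show "A = A' \<and> B = B'"
    if "A \<in> Ob C" "B \<in> Ob C" "A' \<in> Ob C" "B' \<in> Ob C" "f \<in> Mor C B A" "f \<in> Mor C B' A'" for A B A' B' f
    using hom_disjoint[of B A B' A' f] that by simp
qed (simp_all add: hom_comm_group id_closed comp_closed id_left id_right comp_assoc
    comp_add_left comp_add_right)

lemma op_bifunctor: "additive_bifunctor (op_cat C) (Ext (op_cat C))"
proof -
  note E = ext_bifunctor[unfolded additive_bifunctor_def]
  show ?thesis
    unfolding additive_bifunctor_def op_cat_simps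
    apply (intro conjI ballI)
    subgoal by (rule E[THEN conjunct1, rule_format])
    subgoal by (rule E[THEN conjunct2, THEN conjunct1, rule_format])
    subgoal by (rule E[THEN conjunct2, THEN conjunct2, THEN conjunct1, rule_format])
    subgoal by (rule bmap_comp)
    subgoal by (rule E[THEN conjunct2, THEN conjunct2, THEN conjunct2, THEN conjunct2, THEN conjunct2,
            rule_format])
    subgoal by (rule E[THEN conjunct2, THEN conjunct2, THEN conjunct2, THEN conjunct2, THEN conjunct1,
            rule_format])
    done
qed

text \<open>
An equivalence of sequences in the opposite category is given by an isomorphism of middle terms in the
other direction, so that it has to be inverted.
\<close>

lemma seq_equiv_op:
  "((x, y), (x', y')) \<in> seq_equiv (op_cat C) A D \<longleftrightarrow> ((y, x), (y', x')) \<in> seq_equiv C D A"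
  if ob: "A \<in> Ob C" "D \<in> Ob C"
proof
  assume "((x, y), (x', y')) \<in> seq_equiv (op_cat C) A D"
  then obtain B B' b where B: "B \<in> Ob C" "B' \<in> Ob C" "x \<in> Mor C B A" "y \<in> Mor C D B"
    "x' \<in> Mor C B' A" "y' \<in> Mor C D B'" and b: "is_iso C B' B b" "x \<cdot> b = x'" "b \<cdot> y' = y"
    unfolding seq_equiv_def by auto
  have bm: "b \<in> Mor C B' B" using b(1) unfolding is_iso_def by simp
  obtain b' where b': "is_iso C B B' b'" "b' \<cdot> b = Idn C B'" "b \<cdot> b' = Idn C B"
    using is_iso_inverse[OF b(1)] .
  have bm': "b' \<in> Mor C B B'" using b'(1) unfolding is_iso_def by simp
  have "b' \<cdot> y = y'"
    using comp_assoc[OF ob(2) B(2,1,2,6) bm bm'] b(3) b'(2) id_left[OF ob(2) B(2,6)] by simp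
  moreover have "x' \<cdot> b' = x"
    using comp_assoc[OF B(1,2,1) ob(1) bm' bm B(3)] b(2) b'(3) id_right[OF B(1) ob(1) B(3)] by simp
  ultimately show "((y, x), (y', x')) \<in> seq_equiv C D A"
    using B b'(1) unfolding seq_equiv_def by blast
next
  assume "((y, x), (y', x')) \<in> seq_equiv C D A"
  then obtain B B' b where B: "B \<in> Ob C" "B' \<in> Ob C" "x \<in> Mor C B A" "y \<in> Mor C D B"
    "x' \<in> Mor C B' A" "y' \<in> Mor C D B'" and b: "is_iso C B B' b" "b \<cdot> y = y'" "x' \<cdot> b = x"
    unfolding seq_equiv_def by auto
  have bm: "b \<in> Mor C B B'" using b(1) unfolding is_iso_def by simp
  obtain b' where b': "is_iso C B' B b'" "b' \<cdot> b = Idn C B" "b \<cdot> b' = Idn C B'"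
    using is_iso_inverse[OF b(1)] .
  have bm': "b' \<in> Mor C B' B" using b'(1) unfolding is_iso_def by simp
  have "b' \<cdot> y' = y"
    using comp_assoc[OF ob(2) B(1,2,1,4) bm bm'] b(2) b'(2) id_left[OF ob(2) B(1,4)] by simp
  moreover have "x \<cdot> b' = x'"
    using comp_assoc[OF B(2,1,2) ob(1) bm' bm B(5)] b(3) b'(3) id_right[OF B(2) ob(1) B(5)] by simp
  ultimately show "((x, y), (x', y')) \<in> seq_equiv (op_cat C) A D"
    using B b'(1) unfolding seq_equiv_def by auto
qed

lemma op_realization_class:
  assumes ob: "D \<in> Ob C" "A \<in> Ob C" and \<delta>: "\<delta> \<in> Exts C A D"
  shows "prod.swap ` Rlz C A D \<delta> \<in> seqs (op_cat C) A D // seq_equiv (op_cat C) A D"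
proof -
  obtain y x where s: "(y, x) \<in> seqs C D A" and R: "Rlz C A D \<delta> = seq_equiv C D A `` {(y, x)}"
    using realization_class[OF ob(2,1) \<delta>] by (auto elim!: quotientE)
  have "(a, b) \<in> prod.swap ` Rlz C A D \<delta> \<longleftrightarrow> (a, b) \<in> seq_equiv (op_cat C) A D `` {(x, y)}" for a b
    unfolding R swap_image_iff using seq_equiv_op[OF ob(2,1)] by simp
  then have "prod.swap ` Rlz C A D \<delta> = seq_equiv (op_cat C) A D `` {(x, y)}"
    by (auto simp only: set_eq_iff split_paired_All)
  moreover have "(x, y) \<in> seqs (op_cat C) A D"
    using s unfolding seqs_def by auto
  ultimately show ?thesis by (simp add: quotientI)
qed

lemma op_extriangulated: "extriangulated_category (op_cat C)"
proof (intro extriangulated_category.intro extriangulated_category_axioms.intro op_additive op_bifunctor,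
    unfold etriangle_op push_op pull_op biproduct_op op_cat_simps)
  fix D A \<delta> assume "D \<in> Ob C" "A \<in> Ob C" "\<delta> \<in> Exts C A D"
  then show "prod.swap ` Rlz C A D \<delta> \<in> seqs (op_cat C) A D // seq_equiv (op_cat C) A D"
    by (rule op_realization_class)
next
  fix A x B y D \<delta> A' x' B' y' D' \<delta>' a c
  assume "etriangle C D y B x A \<delta>" "etriangle C D' y' B' x' A' \<delta>'" "a \<in> Mor C A' A" "c \<in> Mor C D' D"
    and "pull C D a \<delta> = push C A' c \<delta>'"
  then show "\<exists>b \<in> Mor C B' B. x \<cdot> b = a \<cdot> x' \<and> y \<cdot> c = b \<cdot> y'"
    using realization_morphism[of D' y' B' x' A' \<delta>' D y B x A \<delta> c a] by metis
next
  fix A D P i1 i2 p1 p2 assume "biproduct C A D P p1 p2 i1 i2"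
  then show "etriangle C D p2 P i1 A \<one>\<^bsub>BOb (Ext C) A D\<^esub>"
    using realization_zero biproduct_sym by blast
next
  fix A x B y D \<delta> A' x' B' y' D' \<delta>' AA iA iA' pA pA' BB iB iB' pB pB' DD iD iD' pD pD'
  assume T: "etriangle C D y B x A \<delta>" "etriangle C D' y' B' x' A' \<delta>'"
    and bp: "biproduct C A A' AA pA pA' iA iA'" "biproduct C B B' BB pB pB' iB iB'"
      "biproduct C D D' DD pD pD' iD iD'"
  have ob: "A \<in> Ob C" "A' \<in> Ob C" "AA \<in> Ob C" "B \<in> Ob C" "B' \<in> Ob C" "BB \<in> Ob C"
      "D \<in> Ob C" "D' \<in> Ob C" "DD \<in> Ob C"
    and m: "pA \<in> Mor C A AA" "pA' \<in> Mor C A' AA" "iB \<in> Mor C BB B" "iB' \<in> Mor C BB B'"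
      "pB \<in> Mor C B BB" "pB' \<in> Mor C B' BB" "iD \<in> Mor C DD D" "iD' \<in> Mor C DD D'"
    using bp unfolding biproduct_def by auto
  note d = etriangle_data[OF T(1)] etriangle_data[OF T(2)]
  show "etriangle C DD ((pB \<cdot> (y \<cdot> iD)) \<otimes>\<^bsub>Hom C DD BB\<^esub> (pB' \<cdot> (y' \<cdot> iD')))
      BB ((pA \<cdot> (x \<cdot> iB)) \<otimes>\<^bsub>Hom C BB AA\<^esub> (pA' \<cdot> (x' \<cdot> iB')))
      AA (BMap (Ext C) iA pD \<delta> \<otimes>\<^bsub>BOb (Ext C) AA DD\<^esub> BMap (Ext C) iA' pD' \<delta>')"
    using realization_sum[OF T bp(3,2,1)]
      comp_assoc[OF ob(9,7,4,6) m(7) d(4) m(5)] comp_assoc[OF ob(9,8,5,6) m(8) d(10) m(6)]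
      comp_assoc[OF ob(6,4,1,3) m(3) d(5) m(1)] comp_assoc[OF ob(6,5,2,3) m(4) d(11) m(2)] by simp
next
  fix A x B y D \<delta> A' x' B' y' D' \<delta>' a b
  assume "etriangle C D y B x A \<delta>" "etriangle C D' y' B' x' A' \<delta>'" "a \<in> Mor C A' A" "b \<in> Mor C B' B"
    and "x \<cdot> b = a \<cdot> x'"
  then show "\<exists>c \<in> Mor C D' D. y \<cdot> c = b \<cdot> y' \<and> pull C D a \<delta> = push C A' c \<delta>'"
    using ET3_op[of D' y' B' x' A' \<delta>' D y B x A \<delta> b a] by metis
next
  fix A x B y D \<delta> A' x' B' y' D' \<delta>' b c
  assume "etriangle C D y B x A \<delta>" "etriangle C D' y' B' x' A' \<delta>'" "b \<in> Mor C B' B" "c \<in> Mor C D' D"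
    and "y \<cdot> c = b \<cdot> y'"
  then show "\<exists>a \<in> Mor C A' A. x \<cdot> b = a \<cdot> x' \<and> pull C D a \<delta> = push C A' c \<delta>'"
    using ET3[of D' y' B' x' A' \<delta>' D y B x A \<delta> c b] by metis
next
  fix A f B f' D \<delta> g G g' F \<delta>'
  assume T: "etriangle C D f' B f A \<delta>" "etriangle C F g' G g B \<delta>'"
  show "\<exists>E h' d e \<delta>''. etriangle C E h' G (f \<cdot> g) A \<delta>'' \<and> etriangle C F e E d D (pull C F f' \<delta>') \<and>
      g \<cdot> h' = f' \<cdot> d \<and> h' \<cdot> e = g' \<and> push C A d \<delta>'' = \<delta> \<and> pull C E f \<delta>'' = push C B e \<delta>'"
    using ET4_op[OF T(2,1)] by metis
next
  fix A f B f' D \<delta> g G g' F \<delta>'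
  assume T: "etriangle C B f A f' D \<delta>" "etriangle C G g B g' F \<delta>'"
  show "\<exists>E h' d e \<delta>''. etriangle C G (f \<cdot> g) A h' E \<delta>'' \<and> etriangle C F e E d D (push C D g' \<delta>) \<and>
      h' \<cdot> f = e \<cdot> g' \<and> d \<cdot> h' = f' \<and> pull C G e \<delta>'' = \<delta>' \<and> pull C B d \<delta> = push C E g \<delta>''"
    using ET4[OF T(2,1)] by metis
qed

lemma contra_exact_etriangle_iff:
  assumes T: "etriangle C A f B g D \<delta>" and W: "W \<in> Ob C"
  shows "contra_exact C A f B g D W \<longleftrightarrow>
    (\<forall>u \<in> Mor C D W. u \<cdot> g = \<one>\<^bsub>Hom C B W\<^esub> \<longrightarrow> u = \<one>\<^bsub>Hom C D W\<^esub>) \<and>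
    (\<forall>w \<in> Mor C A W. \<exists>u \<in> Mor C B W. u \<cdot> f = w)"
  using extriangulated_category.cov_exact_etriangle_iff[OF op_extriangulated, of D g B f A \<delta> W] T W
  by simp

end

section \<open>Comparison of relative exact structures\<close>

text \<open>
These two conditions are what the vanishing of negative first extensions is used for: they give exactness
at the left end of the Hom-sequences. Phrased in terms of triangles, they are exchanged by the passage
to the opposite category.
\<close>

definition inflations_monic_on :: "('o, 'm, 'e, 'z) extricat_scheme \<Rightarrow> 'o set \<Rightarrow> bool"
  where "inflations_monic_on C S \<longleftrightarrow> (\<forall>A f B g D \<delta>. etriangle C A f B g D \<delta> \<longrightarrow>
    (\<forall>P \<in> S. \<forall>u \<in> Mor C P A. f \<cdot>\<^bsub>C\<^esub> u = \<one>\<^bsub>Hom C P B\<^esub> \<longrightarrow> u = \<one>\<^bsub>Hom C P A\<^esub>))"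

definition deflations_epic_on :: "('o, 'm, 'e, 'z) extricat_scheme \<Rightarrow> 'o set \<Rightarrow> bool"
  where "deflations_epic_on C T \<longleftrightarrow> (\<forall>A f B g D \<delta>. etriangle C A f B g D \<delta> \<longrightarrow>
    (\<forall>Q \<in> T. \<forall>u \<in> Mor C D Q. u \<cdot>\<^bsub>C\<^esub> g = \<one>\<^bsub>Hom C B Q\<^esub> \<longrightarrow> u = \<one>\<^bsub>Hom C D Q\<^esub>))"

lemma inflations_monic_on_op [simp]: "inflations_monic_on (op_cat C) T \<longleftrightarrow> deflations_epic_on C T"
  and deflations_epic_on_op [simp]: "deflations_epic_on (op_cat C) S \<longleftrightarrow> inflations_monic_on C S"
  unfolding inflations_monic_on_def deflations_epic_on_def etriangle_op op_cat_simps by meson+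

context extriangulated_category
begin

text \<open>
An object \<open>D\<close> has one triangle \<open>K \<rightarrow> P \<rightarrow> D\<close> that solves all extension problems with values in \<open>T\<close>. Any
triangle \<open>A \<rightarrow> B \<rightarrow> D\<close> along which maps from \<open>P\<close> lift is a pushout of it along some \<open>a : K \<rightarrow> A\<close>, and
inherits the solvability of extension problems: the obstruction \<open>u\<^sub>*\<delta>\<close> of \<open>u : A \<rightarrow> Q\<close> is the obstruction
of \<open>u a\<close>.
\<close>

lemma xi_lower_subset_xi_upper:
  assumes T_ob: "T \<subseteq> Ob C" and epic: "deflations_epic_on C T"
    and approx: "\<And>D. D \<in> Ob C \<Longrightarrow> \<exists>K k P p \<epsilon>. P \<in> S \<and> etriangle C K k P p D \<epsilon> \<and>
      (\<forall>Q \<in> T. \<forall>u \<in> Mor C K Q. \<exists>v \<in> Mor C P Q. v \<cdot> k = u)"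
    and xi: "(A, x, B, y, D, \<delta>) \<in> xi_lower C S"
  shows "(A, x, B, y, D, \<delta>) \<in> xi_upper C T"
proof -
  have T: "etriangle C A x B y D \<delta>" using xi by (rule xi_lower_etriangle)
  note d = etriangle_data[OF T]
  obtain K k P p \<epsilon> where P: "P \<in> S" and E: "etriangle C K k P p D \<epsilon>"
    and ext: "\<And>Q u. \<lbrakk>Q \<in> T; u \<in> Mor C K Q\<rbrakk> \<Longrightarrow> \<exists>v \<in> Mor C P Q. v \<cdot> k = u"
    using approx[OF d(3)] by blast
  note e = etriangle_data[OF E]
  have "cov_exact C P A x B y D" using xi P unfolding xi_lower_def by simp
  then obtain b where b: "b \<in> Mor C P B" "y \<cdot> b = p"
    using e(5) unfolding cov_exact_etriangle_iff[OF T e(2)] by blast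
  then obtain a where a: "a \<in> Mor C K A" "push C D a \<epsilon> = pull C A (Idn C D) \<delta>"
    using ET3_op[OF E T b(1) id_closed[OF d(3)]] id_left[OF e(2) d(3) e(5)] by auto
  have "contra_exact C A x B y D Q" if Q: "Q \<in> T" for Q
  proof -
    have Qo: "Q \<in> Ob C" using Q T_ob by blast
    have "\<exists>v \<in> Mor C B Q. v \<cdot> x = u" if u: "u \<in> Mor C A Q" for u
    proof -
      have ua: "u \<cdot> a \<in> Mor C K Q" using comp_closed[OF e(1) d(1) Qo a(1) u] .
      have "push C D u \<delta> = push C D (u \<cdot> a) \<epsilon>"
        using push_comp[OF d(3) e(1) d(1) Qo a(1) u e(6)] a(2) pull_id[OF d(3,1,6)] by simp
      also have "\<dots> = \<one>\<^bsub>BOb (Ext C) D Q\<^esub>"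
        using push_zero_iff_extends[OF E Qo ua] ext[OF Q ua] by blast
      finally show ?thesis using push_zero_iff_extends[OF T Qo u] by blast
    qed
    moreover have "u = \<one>\<^bsub>Hom C D Q\<^esub>" if "u \<in> Mor C D Q" "u \<cdot> y = \<one>\<^bsub>Hom C B Q\<^esub>" for u
      using epic T Q that unfolding deflations_epic_on_def by blast
    ultimately show ?thesis unfolding contra_exact_etriangle_iff[OF T Qo] by blast
  qed
  then show ?thesis using T unfolding xi_upper_def by simp
qed

end

section \<open>Functors\<close>

lemma additive_functorD:
  assumes "additive_functor C D F"
  shows "A \<in> Ob C \<Longrightarrow> FOb F A \<in> Ob D"
    and "\<lbrakk>A \<in> Ob C; B \<in> Ob C; f \<in> Mor C A B\<rbrakk> \<Longrightarrow> FMor F f \<in> Mor D (FOb F A) (FOb F B)"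
    and "A \<in> Ob C \<Longrightarrow> FMor F (Idn C A) = Idn D (FOb F A)"
    and "\<lbrakk>X \<in> Ob C; Y \<in> Ob C; Z \<in> Ob C; f \<in> Mor C X Y; g \<in> Mor C Y Z\<rbrakk>
      \<Longrightarrow> FMor F (g \<cdot>\<^bsub>C\<^esub> f) = FMor F g \<cdot>\<^bsub>D\<^esub> FMor F f"
proof -
  show "A \<in> Ob C \<Longrightarrow> FOb F A \<in> Ob D" "A \<in> Ob C \<Longrightarrow> FMor F (Idn C A) = Idn D (FOb F A)"
    "\<lbrakk>X \<in> Ob C; Y \<in> Ob C; Z \<in> Ob C; f \<in> Mor C X Y; g \<in> Mor C Y Z\<rbrakk>
      \<Longrightarrow> FMor F (g \<cdot>\<^bsub>C\<^esub> f) = FMor F g \<cdot>\<^bsub>D\<^esub> FMor F f"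
    using assms unfolding additive_functor_def by simp_all
  assume "A \<in> Ob C" "B \<in> Ob C" "f \<in> Mor C A B"
  then show "FMor F f \<in> Mor D (FOb F A) (FOb F B)"
    using assms hom_in_carrier[of "FMor F"] unfolding additive_functor_def by blast
qed

lemma additive_functor_op: "additive_functor (op_cat C) (op_cat D) F \<longleftrightarrow> additive_functor C D F"
  unfolding additive_functor_def op_cat_simps by meson

lemma adjunction_op:
  assumes "adjunction C D F G u v"
  shows "adjunction (op_cat D) (op_cat C) G F v u"
  using assms unfolding adjunction_def op_cat_simps by simp

lemma fully_faithful_op:
  "fully_faithful (op_cat C) (op_cat D) F \<longleftrightarrow> fully_faithful C D F"
  unfolding fully_faithful_def op_cat_simps by meson

text \<open>
The family \<open>\<phi>\<close> is a natural isomorphism from \<open>F L\<close> to the identity.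
\<close>

definition left_inverse_functor ::
    "('p, 'n, 'z) precat_scheme \<Rightarrow> ('o, 'm, 'p, 'n) functor_data \<Rightarrow> ('p, 'n, 'o, 'm) functor_data \<Rightarrow> bool"
  where "left_inverse_functor D F L \<longleftrightarrow> (\<exists>\<phi>.
    (\<forall>X \<in> Ob D. is_iso D (FOb F (FOb L X)) X (\<phi> X)) \<and>
    (\<forall>X \<in> Ob D. \<forall>Y \<in> Ob D. \<forall>w \<in> Mor D X Y. w \<cdot>\<^bsub>D\<^esub> \<phi> X = \<phi> Y \<cdot>\<^bsub>D\<^esub> FMor F (FMor L w)))"

text \<open>
If the left adjoint \<open>F\<close> is fully faithful, the counit at \<open>F X\<close> is the image of a map, and the triangle
identities say that this map is inverse to the unit.
\<close>

lemma unit_iso: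
  assumes C: "preadditive_category C" and D: "preadditive_category D"
    and F: "additive_functor C D F" and G: "additive_functor D C G"
    and adj: "adjunction C D F G u v" and ff: "fully_faithful C D F" and X: "X \<in> Ob C"
  shows "is_iso C X (FOb G (FOb F X)) (u X)"
proof -
  interpret C: preadditive_category C by (rule C)
  interpret D: preadditive_category D by (rule D)
  note f = additive_functorD[OF F] and g = additive_functorD[OF G]
  have FX: "FOb F X \<in> Ob D" and GFX: "FOb G (FOb F X) \<in> Ob C" using f(1) g(1) X by simp_all
  have u: "u X \<in> Mor C X (FOb G (FOb F X))" and v: "v (FOb F X) \<in> Mor D (FOb F (FOb G (FOb F X))) (FOb F X)"
    and tri: "v (FOb F X) \<cdot>\<^bsub>D\<^esub> FMor F (u X) = Idn D (FOb F X)"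
      "FMor G (v (FOb F X)) \<cdot>\<^bsub>C\<^esub> u (FOb G (FOb F X)) = Idn C (FOb G (FOb F X))"
    and nat: "\<And>f. f \<in> Mor C (FOb G (FOb F X)) X \<Longrightarrow>
      u X \<cdot>\<^bsub>C\<^esub> f = FMor G (FMor F f) \<cdot>\<^bsub>C\<^esub> u (FOb G (FOb F X))"
    using adj X FX GFX unfolding adjunction_def by simp_all
  have "v (FOb F X) \<in> FMor F ` Mor C (FOb G (FOb F X)) X"
    using ff X GFX v unfolding fully_faithful_def bij_betw_def by blast
  then obtain w where w: "w \<in> Mor C (FOb G (FOb F X)) X" "FMor F w = v (FOb F X)" by auto
  have "FMor F (w \<cdot>\<^bsub>C\<^esub> u X) = FMor F (Idn C X)"
    using f(4)[OF X GFX X u w(1)] w(2) tri(1) f(3)[OF X] by simp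
  moreover have "inj_on (FMor F) (Mor C X X)"
    using ff X unfolding fully_faithful_def bij_betw_def by blast
  ultimately have "w \<cdot>\<^bsub>C\<^esub> u X = Idn C X"
    using C.comp_closed[OF X GFX X u w(1)] C.id_closed[OF X] by (simp add: inj_on_eq_iff)
  moreover have "u X \<cdot>\<^bsub>C\<^esub> w = Idn C (FOb G (FOb F X))"
    using nat[OF w(1)] w(2) tri(2) by simp
  ultimately show ?thesis using u w(1) unfolding is_iso_def by blast
qed

text \<open>
Here the natural isomorphism is the inverse of the unit, whose naturality has to be derived from that
of the unit.
\<close>

lemma right_adjoint_left_inverse:
  assumes C: "preadditive_category C" and D: "preadditive_category D"
    and F: "additive_functor C D F" and G: "additive_functor D C G"
    and adj: "adjunction C D F G u v" and ff: "fully_faithful C D F"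
  shows "left_inverse_functor C G F"
proof -
  interpret C: preadditive_category C by (rule C)
  note f = additive_functorD[OF F] and g = additive_functorD[OF G]
  have "\<exists>w. is_iso C (FOb G (FOb F X)) X w \<and> w \<cdot>\<^bsub>C\<^esub> u X = Idn C X \<and> u X \<cdot>\<^bsub>C\<^esub> w = Idn C (FOb G (FOb F X))"
    if "X \<in> Ob C" for X
    using C.is_iso_inverse[OF unit_iso[OF assms that]] by blast
  then obtain \<phi> where \<phi>: "\<And>X. X \<in> Ob C \<Longrightarrow> is_iso C (FOb G (FOb F X)) X (\<phi> X)"
    "\<And>X. X \<in> Ob C \<Longrightarrow> \<phi> X \<cdot>\<^bsub>C\<^esub> u X = Idn C X"
    "\<And>X. X \<in> Ob C \<Longrightarrow> u X \<cdot>\<^bsub>C\<^esub> \<phi> X = Idn C (FOb G (FOb F X))"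
    by metis
  have "w \<cdot>\<^bsub>C\<^esub> \<phi> X = \<phi> Y \<cdot>\<^bsub>C\<^esub> FMor G (FMor F w)"
    if X: "X \<in> Ob C" and Y: "Y \<in> Ob C" and w: "w \<in> Mor C X Y" for X Y w
  proof -
    let ?X = "FOb G (FOb F X)" and ?Y = "FOb G (FOb F Y)" and ?w = "FMor G (FMor F w)"
    have ob: "?X \<in> Ob C" "?Y \<in> Ob C" using f(1) g(1) X Y by simp_all
    have u: "u X \<in> Mor C X ?X" "u Y \<in> Mor C Y ?Y" and nat: "u Y \<cdot>\<^bsub>C\<^esub> w = ?w \<cdot>\<^bsub>C\<^esub> u X"
      using adj X Y w unfolding adjunction_def by simp_all
    have p: "\<phi> X \<in> Mor C ?X X" "\<phi> Y \<in> Mor C ?Y Y" using \<phi>(1) X Y unfolding is_iso_def by simp_all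
    have gw: "?w \<in> Mor C ?X ?Y" using f(1,2) g(2) X Y w by simp
    have wp: "w \<cdot>\<^bsub>C\<^esub> \<phi> X \<in> Mor C ?X Y" using C.comp_closed[OF ob(1) X Y p(1) w] .
    have "w \<cdot>\<^bsub>C\<^esub> \<phi> X = (\<phi> Y \<cdot>\<^bsub>C\<^esub> u Y) \<cdot>\<^bsub>C\<^esub> (w \<cdot>\<^bsub>C\<^esub> \<phi> X)"
      using \<phi>(2)[OF Y] C.id_left[OF ob(1) Y wp] by simp
    also have "\<dots> = \<phi> Y \<cdot>\<^bsub>C\<^esub> ((u Y \<cdot>\<^bsub>C\<^esub> w) \<cdot>\<^bsub>C\<^esub> \<phi> X)"
      using C.comp_assoc[OF ob(1) Y ob(2) Y wp u(2) p(2)] C.comp_assoc[OF ob(1) X Y ob(2) p(1) w u(2)]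
      by simp
    also have "(u Y \<cdot>\<^bsub>C\<^esub> w) \<cdot>\<^bsub>C\<^esub> \<phi> X = ?w"
      using nat C.comp_assoc[OF ob(1) X ob(1,2) p(1) u(1) gw] \<phi>(3)[OF X] C.id_right[OF ob gw] by simp
    finally show ?thesis .
  qed
  then show ?thesis using \<phi>(1) unfolding left_inverse_functor_def by blast
qed

text \<open>
Here it is the counit, which is the unit of the opposite adjunction.
\<close>

lemma left_adjoint_left_inverse:
  assumes C: "extriangulated_category C" and D: "extriangulated_category D"
    and F: "additive_functor C D F" and G: "additive_functor D C G"
    and adj: "adjunction C D F G u v" and ff: "fully_faithful D C G"
  shows "left_inverse_functor D F G"
proof -
  have op: "preadditive_category (op_cat C)" "preadditive_category (op_cat D)"
    using C D extriangulated_category.op_additive additive_category.axioms(1) by blast+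
  have "is_iso D (FOb F (FOb G Y)) Y (v Y)" if "Y \<in> Ob D" for Y
    using unit_iso[OF op(2,1) _ _ adjunction_op[OF adj], of Y] that F G ff
    by (simp add: additive_functor_op fully_faithful_op)
  then show ?thesis
    using adj unfolding left_inverse_functor_def adjunction_def by blast
qed

section \<open>Relative projectives along an exact functor\<close>

text \<open>
One half of the situation: \<open>F\<close> has a right adjoint \<open>R\<close>, which turns extension problems with values in \<open>T\<close>
into extension problems with values in \<open>Y\<close>, and a one-sided inverse \<open>L\<close>, which turns lifting problems on
\<open>S = F X\<close> into lifting problems on \<open>X\<close>. The set \<open>T\<close> is kept general, since in the applications it is the
image of \<open>Y\<close> under a functor that may differ from \<open>F\<close>.
\<close>

locale projective_transfer = B: extriangulated_category CB + D: extriangulated_category CD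
  for CB :: "('o, 'm, 'e, 'y) extricat_scheme" and CD :: "('p, 'n, 'f, 'z) extricat_scheme" +
  fixes F :: "('o, 'm, 'p, 'n) functor_data" and L R :: "('p, 'n, 'o, 'm) functor_data"
    and u :: "'o \<Rightarrow> 'm" and v :: "'p \<Rightarrow> 'n" and XX YY :: "'o set" and T :: "'p set"
  assumes F: "additive_functor CB CD F" and L: "additive_functor CD CB L"
    and R: "additive_functor CD CB R"
    and F_triangle: "etriangle CB A x B y X \<delta> \<Longrightarrow>
      \<exists>\<epsilon>. etriangle CD (FOb F A) (FMor F x) (FOb F B) (FMor F y) (FOb F X) \<epsilon>"
    and FL: "left_inverse_functor CD F L" and adj: "adjunction CB CD F R u v"
    and XX_proj: "XX = proj_obs CB (xi_lower CB XX)"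
    and xi: "xi_lower CB XX \<subseteq> xi_upper CB YY"
    and enough: "enough_projectives CB (xi_lower CB XX)"
    and L_X: "P \<in> ess_image CD F XX \<Longrightarrow> FOb L P \<in> XX"
    and R_T: "Q \<in> T \<Longrightarrow> FOb R Q \<in> YY"
    and T_ob: "T \<subseteq> Ob CD"
    and monic: "inflations_monic_on CD (ess_image CD F XX)"
    and epic: "deflations_epic_on CD T"
begin

abbreviation S :: "'p set"
  where "S \<equiv> ess_image CD F XX"

text \<open>
The triangle is the image under \<open>F\<close> of a relative projective cover \<open>K \<rightarrow> X \<rightarrow> L D\<close>, with its end \<open>F L D\<close>
replaced by \<open>D\<close>. Lifting problems are moved to this cover by \<open>L\<close>, extension problems by the adjunction
of \<open>F\<close> and \<open>R\<close>.
\<close>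

lemma approximation:
  assumes D: "D \<in> Ob CD"
  shows "\<exists>K k P p \<epsilon>. P \<in> S \<and> (K, k, P, p, D, \<epsilon>) \<in> xi_lower CD S \<and>
    (\<forall>Q \<in> T. \<forall>w \<in> Mor CD K Q. \<exists>t \<in> Mor CD P Q. t \<cdot>\<^bsub>CD\<^esub> k = w)"
proof -
  note f = additive_functorD[OF F] and l = additive_functorD[OF L] and r = additive_functorD[OF R]
  obtain \<phi> where \<phi>: "\<And>X. X \<in> Ob CD \<Longrightarrow> is_iso CD (FOb F (FOb L X)) X (\<phi> X)"
    and nat: "\<And>X Y w. \<lbrakk>X \<in> Ob CD; Y \<in> Ob CD; w \<in> Mor CD X Y\<rbrakk> \<Longrightarrow>
      w \<cdot>\<^bsub>CD\<^esub> \<phi> X = \<phi> Y \<cdot>\<^bsub>CD\<^esub> FMor F (FMor L w)"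
    using FL unfolding left_inverse_functor_def by blast
  have LD: "FOb L D \<in> Ob CB" using l(1)[OF D] .
  then obtain K k X g \<delta> where X: "X \<in> XX" and K: "(K, k, X, g, FOb L D, \<delta>) \<in> xi_lower CB XX"
    using enough XX_proj unfolding enough_projectives_def by blast
  have T0: "etriangle CB K k X g (FOb L D) \<delta>" using K by (rule B.xi_lower_etriangle)
  note d = B.etriangle_data[OF T0]
  obtain \<epsilon>\<^sub>0 where T1: "etriangle CD (FOb F K) (FMor F k) (FOb F X) (FMor F g) (FOb F (FOb L D)) \<epsilon>\<^sub>0"
    using F_triangle[OF T0] by blast
  note e = D.etriangle_data[OF T1]
  obtain E h \<epsilon> c where T2: "etriangle CD E h (FOb F X) (\<phi> D \<cdot>\<^bsub>CD\<^esub> FMor F g) D \<epsilon>"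
    and c: "c \<in> Mor CD (FOb F K) E" "h \<cdot>\<^bsub>CD\<^esub> c = FMor F k"
    and c_epi: "\<And>Q w w'. \<lbrakk>Q \<in> Ob CD; w \<in> Mor CD E Q; w' \<in> Mor CD E Q;
      w \<cdot>\<^bsub>CD\<^esub> c = w' \<cdot>\<^bsub>CD\<^esub> c\<rbrakk> \<Longrightarrow> w = w'"
    using D.etriangle_replace_end[OF T1 D \<phi>[OF D]] by metis
  note e2 = D.etriangle_data[OF T2]
  have \<phi>m: "\<phi> Z \<in> Mor CD (FOb F (FOb L Z)) Z" if "Z \<in> Ob CD" for Z
    using \<phi>[OF that] unfolding is_iso_def by simp
  \<comment> \<open>Lift \<open>L w\<close> along \<open>g\<close> and apply \<open>F\<close>; naturality of \<open>\<phi>\<close> recovers \<open>w\<close>.\<close>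
  have lift: "\<exists>t \<in> Mor CD P (FOb F X). (\<phi> D \<cdot>\<^bsub>CD\<^esub> FMor F g) \<cdot>\<^bsub>CD\<^esub> t = w"
    if P: "P \<in> S" and w: "w \<in> Mor CD P D" for P w
  proof -
    have Po: "P \<in> Ob CD" using P unfolding ess_image_def by simp
    note o = Po f(1)[OF l(1)[OF Po]]
    have Lw: "FMor L w \<in> Mor CB (FOb L P) (FOb L D)" using l(2)[OF Po D w] .
    have "cov_exact CB (FOb L P) K k X g (FOb L D)"
      using K L_X[OF P] unfolding xi_lower_def by simp
    then obtain t where t: "t \<in> Mor CB (FOb L P) X" "g \<cdot>\<^bsub>CB\<^esub> t = FMor L w"
      using Lw unfolding B.cov_exact_etriangle_iff[OF T0 l(1)[OF Po]] by blast
    have Ft: "FMor F t \<in> Mor CD (FOb F (FOb L P)) (FOb F X)" using f(2)[OF l(1)[OF Po] d(2) t(1)] .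
    obtain \<psi> where \<psi>: "\<psi> \<in> Mor CD P (FOb F (FOb L P))" "\<phi> P \<cdot>\<^bsub>CD\<^esub> \<psi> = Idn CD P"
      using \<phi>[OF Po] unfolding is_iso_def by blast
    have "(\<phi> D \<cdot>\<^bsub>CD\<^esub> FMor F g) \<cdot>\<^bsub>CD\<^esub> FMor F t = \<phi> D \<cdot>\<^bsub>CD\<^esub> FMor F (FMor L w)"
      using D.comp_assoc[OF o(2) e(2,3) D Ft e(5) \<phi>m[OF D]] f(4)[OF l(1)[OF Po] d(2,3) t(1) d(5)] t(2)
      by simp
    also have "\<dots> = w \<cdot>\<^bsub>CD\<^esub> \<phi> P" using nat[OF Po D w] by simp
    finally have *: "(\<phi> D \<cdot>\<^bsub>CD\<^esub> FMor F g) \<cdot>\<^bsub>CD\<^esub> FMor F t = w \<cdot>\<^bsub>CD\<^esub> \<phi> P" .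
    have "(\<phi> D \<cdot>\<^bsub>CD\<^esub> FMor F g) \<cdot>\<^bsub>CD\<^esub> (FMor F t \<cdot>\<^bsub>CD\<^esub> \<psi>) = w"
      using D.comp_assoc[OF o(1,2) e(2) D \<psi>(1) Ft e2(5)] * D.comp_assoc[OF o(1,2,1) D \<psi>(1) \<phi>m[OF Po] w]
        \<psi>(2) D.id_right[OF Po D w] by simp
    then show ?thesis using D.comp_closed[OF o(1,2) e(2) \<psi>(1) Ft] by blast
  qed
  have FX: "FOb F X \<in> S"
    using D.mem_ess_image[OF X e(2) D.is_iso_id[OF e(2)]] .
  have "cov_exact CD P E h (FOb F X) (\<phi> D \<cdot>\<^bsub>CD\<^esub> FMor F g) D" if P: "P \<in> S" for P
  proof -
    have Po: "P \<in> Ob CD" using P unfolding ess_image_def by simp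
    have "w = \<one>\<^bsub>Hom CD P E\<^esub>" if "w \<in> Mor CD P E" "h \<cdot>\<^bsub>CD\<^esub> w = \<one>\<^bsub>Hom CD P (FOb F X)\<^esub>" for w
      using monic T2 P that unfolding inflations_monic_on_def by blast
    then show ?thesis using lift[OF P] unfolding D.cov_exact_etriangle_iff[OF T2 Po] by blast
  qed
  then have in_xi: "(E, h, FOb F X, \<phi> D \<cdot>\<^bsub>CD\<^esub> FMor F g, D, \<epsilon>) \<in> xi_lower CD S"
    using T2 unfolding xi_lower_def by simp
  have "\<exists>t \<in> Mor CD (FOb F X) Q. t \<cdot>\<^bsub>CD\<^esub> h = w" if Q: "Q \<in> T" and w: "w \<in> Mor CD E Q" for Q w
  proof -
    have Qo: "Q \<in> Ob CD" using Q T_ob by blast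
    have RQ: "FOb R Q \<in> Ob CB" using r(1)[OF Qo] .
    have FRQ: "FOb F (FOb R Q) \<in> Ob CD" using f(1)[OF RQ] .
    \<comment> \<open>Extend the transpose \<open>R (w c) \<cdot> u\<^sub>K\<close> of \<open>w c : F K \<rightarrow> Q\<close> along \<open>k\<close>, transpose back, and
      cancel \<open>c\<close>.\<close>
    let ?w = "w \<cdot>\<^bsub>CD\<^esub> c"
    have wc: "?w \<in> Mor CD (FOb F K) Q" using D.comp_closed[OF e(1) e2(1) Qo c(1) w] .
    have RFK: "FOb R (FOb F K) \<in> Ob CB" using r(1)[OF e(1)] .
    have FRFK: "FOb F (FOb R (FOb F K)) \<in> Ob CD" using f(1)[OF RFK] .
    have Rw: "FMor R ?w \<in> Mor CB (FOb R (FOb F K)) (FOb R Q)" using r(2)[OF e(1) Qo wc] .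
    have FRw: "FMor F (FMor R ?w) \<in> Mor CD (FOb F (FOb R (FOb F K))) (FOb F (FOb R Q))"
      using f(2)[OF RFK RQ Rw] .
    have uK: "u K \<in> Mor CB K (FOb R (FOb F K))" and vQ: "v Q \<in> Mor CD (FOb F (FOb R Q)) Q"
      and vK: "v (FOb F K) \<in> Mor CD (FOb F (FOb R (FOb F K))) (FOb F K)"
      and tri: "v (FOb F K) \<cdot>\<^bsub>CD\<^esub> FMor F (u K) = Idn CD (FOb F K)"
      and vnat: "?w \<cdot>\<^bsub>CD\<^esub> v (FOb F K) = v Q \<cdot>\<^bsub>CD\<^esub> FMor F (FMor R ?w)"
      using adj d(1) Qo e(1) wc unfolding adjunction_def by simp_all
    have FuK: "FMor F (u K) \<in> Mor CD (FOb F K) (FOb F (FOb R (FOb F K)))" using f(2)[OF d(1) RFK uK] .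
    have "contra_exact CB K k X g (FOb L D) (FOb R Q)"
      using xi K R_T[OF Q] unfolding xi_upper_def by blast
    then obtain t where t: "t \<in> Mor CB X (FOb R Q)" "t \<cdot>\<^bsub>CB\<^esub> k = FMor R ?w \<cdot>\<^bsub>CB\<^esub> u K"
      using B.comp_closed[OF d(1) RFK RQ uK Rw] unfolding B.contra_exact_etriangle_iff[OF T0 RQ] by blast
    have Ft: "FMor F t \<in> Mor CD (FOb F X) (FOb F (FOb R Q))" using f(2)[OF d(2) RQ t(1)] .
    let ?t = "v Q \<cdot>\<^bsub>CD\<^esub> FMor F t"
    have tm: "?t \<in> Mor CD (FOb F X) Q" using D.comp_closed[OF e(2) FRQ Qo Ft vQ] .
    have "?t \<cdot>\<^bsub>CD\<^esub> FMor F k = v Q \<cdot>\<^bsub>CD\<^esub> FMor F (t \<cdot>\<^bsub>CB\<^esub> k)"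
      using D.comp_assoc[OF e(1,2) FRQ Qo e(4) Ft vQ] f(4)[OF d(1,2) RQ d(4) t(1)] by simp
    also have "\<dots> = v Q \<cdot>\<^bsub>CD\<^esub> (FMor F (FMor R ?w) \<cdot>\<^bsub>CD\<^esub> FMor F (u K))"
      using t(2) f(4)[OF d(1) RFK RQ uK Rw] by simp
    also have "\<dots> = (?w \<cdot>\<^bsub>CD\<^esub> v (FOb F K)) \<cdot>\<^bsub>CD\<^esub> FMor F (u K)"
      using D.comp_assoc[OF e(1) FRFK FRQ Qo FuK FRw vQ] vnat by simp
    also have "\<dots> = ?w"
      using D.comp_assoc[OF e(1) FRFK e(1) Qo FuK vK wc] tri D.id_right[OF e(1) Qo wc] by simp
    finally have "(?t \<cdot>\<^bsub>CD\<^esub> h) \<cdot>\<^bsub>CD\<^esub> c = w \<cdot>\<^bsub>CD\<^esub> c"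
      using D.comp_assoc[OF e(1) e2(1,2) Qo c(1) e2(4) tm] c(2) by simp
    moreover have th: "?t \<cdot>\<^bsub>CD\<^esub> h \<in> Mor CD E Q" using D.comp_closed[OF e2(1,2) Qo e2(4) tm] .
    ultimately have "?t \<cdot>\<^bsub>CD\<^esub> h = w"
      using c_epi[OF Qo _ w] by blast
    then show ?thesis using tm by blast
  qed
  then show ?thesis using FX in_xi by blast
qed

lemma xi_lower_subset_xi_upper: "(A, x, B, y, D, \<delta>) \<in> xi_lower CD S \<Longrightarrow> (A, x, B, y, D, \<delta>) \<in> xi_upper CD T"
proof (rule D.xi_lower_subset_xi_upper[OF T_ob epic])
  fix D assume "D \<in> Ob CD"
  then show "\<exists>K k P p \<epsilon>. P \<in> S \<and> etriangle CD K k P p D \<epsilon> \<and>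
      (\<forall>Q \<in> T. \<forall>u \<in> Mor CD K Q. \<exists>v \<in> Mor CD P Q. v \<cdot>\<^bsub>CD\<^esub> k = u)"
    using approximation D.xi_lower_etriangle by meson
qed

text \<open>
A retract of an object of \<open>S\<close> is taken by \<open>L\<close> to a retract of an object of \<open>X\<close>, hence into \<open>X\<close>, and
\<open>F\<close> brings it back.
\<close>

lemma S_retract:
  assumes P: "P \<in> S" and W: "W \<in> Ob CD"
    and s: "s \<in> Mor CD W P" and q: "q \<in> Mor CD P W" and qs: "q \<cdot>\<^bsub>CD\<^esub> s = Idn CD W"
  shows "W \<in> S"
proof -
  note l = additive_functorD[OF L]
  have Po: "P \<in> Ob CD" using P unfolding ess_image_def by simp
  have LP: "FOb L P \<in> proj_obs CB (xi_lower CB XX)" using L_X[OF P] XX_proj by simp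
  have "FMor L q \<cdot>\<^bsub>CB\<^esub> FMor L s = Idn CB (FOb L W)"
    using l(4)[OF W Po W s q] qs l(3)[OF W] by simp
  then have LW: "FOb L W \<in> XX"
    using B.proj_obs_retract[OF LP l(1)[OF W] l(2)[OF W Po s] l(2)[OF Po W q]] XX_proj by simp
  obtain \<phi> where "is_iso CD (FOb F (FOb L W)) W (\<phi> W)"
    using FL W unfolding left_inverse_functor_def by blast
  then show ?thesis by (rule D.mem_ess_image[OF LW W])
qed

text \<open>
If \<open>W\<close> is relatively projective, the identity of \<open>W\<close> lifts along its cover, which makes \<open>W\<close> a retract of
an object of \<open>S\<close>.
\<close>

lemma S_proj: "S = proj_obs CD (xi_lower CD S)"
proof (intro equalityI subsetI)
  fix P assume "P \<in> S"
  then show "P \<in> proj_obs CD (xi_lower CD S)"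
    unfolding proj_obs_iff by (simp add: xi_lower_def ess_image_def)
next
  fix W assume W: "W \<in> proj_obs CD (xi_lower CD S)"
  then have Wo: "W \<in> Ob CD" by (simp add: proj_obs_def)
  obtain K k P p \<epsilon> where P: "P \<in> S" and xi: "(K, k, P, p, W, \<epsilon>) \<in> xi_lower CD S"
    using approximation[OF Wo] by blast
  have T: "etriangle CD K k P p W \<epsilon>" using xi by (rule D.xi_lower_etriangle)
  obtain s where "s \<in> Mor CD W P" "p \<cdot>\<^bsub>CD\<^esub> s = Idn CD W"
    using proj_obsD(2)[OF W xi] D.id_closed[OF Wo] unfolding D.cov_exact_etriangle_iff[OF T Wo] by blast
  then show "W \<in> S" using S_retract[OF P Wo _ D.etriangle_data(5)[OF T]] by blast
qed

lemma S_enough: "enough_projectives CD (xi_lower CD S)"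
  unfolding enough_projectives_def S_proj[symmetric] using approximation by blast

lemma S_full_additive: "full_additive_subcategory CD S"
  using D.proj_obs_full_additive[of S] S_proj by simp

lemma S_closed_under_summands: "closed_under_summands CD S"
  using D.proj_obs_closed_under_summands[of S] S_proj by simp

end

section \<open>Transfer of balanced pairs\<close>

text \<open>
The projective half is applied to \<open>F\<close>, and to \<open>G\<close> between the opposite categories, where \<open>L'\<close> becomes
the right adjoint of \<open>G\<close> and relative injectives become relative projectives. The two inclusions
obtained in this way are the two halves of \<open>\<xi>\<^sub>S = \<xi>\<^sup>T\<close>.
\<close>

lemma balanced_pair_transfer:
  fixes CB :: "('o, 'm, 'e, 'y) extricat_scheme" and CD :: "('p, 'n, 'f, 'z) extricat_scheme"
  assumes CB: "extriangulated_category CB" and CD: "extriangulated_category CD"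
    and F: "exact_functor CB CD F" and G: "exact_functor CB CD G"
    and functors: "additive_functor CD CB L" "additive_functor CD CB R"
      "additive_functor CD CB L'" "additive_functor CD CB R'"
    and FR: "adjunction CB CD F R u v" and LG: "adjunction CD CB L' G u' v'"
    and FL: "left_inverse_functor CD F L" and GR: "left_inverse_functor (op_cat CD) G R'"
    and bal: "balanced_pair CB XX YY"
    and X: "ess_image CB L (ess_image CD F XX) \<subseteq> XX" "ess_image CB L' (ess_image CD F XX) \<subseteq> XX"
    and Y: "ess_image CB R (ess_image CD G YY) \<subseteq> YY" "ess_image CB R' (ess_image CD G YY) \<subseteq> YY"
    and monic: "inflations_monic_on CD (ess_image CD F XX)"
    and epic: "deflations_epic_on CD (ess_image CD G YY)"
  shows "balanced_pair CD (ess_image CD F XX) (ess_image CD G YY)"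
proof -
  interpret B: extriangulated_category CB by (rule CB)
  interpret D: extriangulated_category CD by (rule CD)
  have bal_eq: "xi_lower CB XX = xi_upper CB YY"
    and bal_X: "XX = proj_obs CB (xi_lower CB XX)" "enough_projectives CB (xi_lower CB XX)"
    and bal_Y: "YY = inj_obs CB (xi_upper CB YY)" "enough_injectives CB (xi_upper CB YY)"
    using bal unfolding balanced_pair_def by blast+
  have triangles: "\<exists>\<epsilon>. etriangle CD (FOb H A) (FMor H x) (FOb H B) (FMor H y) (FOb H X) \<epsilon>"
    if "exact_functor CB CD H" "etriangle CB A x B y X \<delta>" for H A x B y X \<delta>
  proof -
    have "\<exists>\<eta>. \<forall>A x B y X \<delta>. etriangle CB A x B y X \<delta> \<longrightarrow>
        etriangle CD (FOb H A) (FMor H x) (FOb H B) (FMor H y) (FOb H X) (\<eta> X A \<delta>)"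
      using that(1) unfolding exact_functor_def by (elim conjE exE) (rule exI)
    then show ?thesis using that(2) by meson
  qed
  have additive: "additive_functor CB CD H" if "exact_functor CB CD H" for H
    using that unfolding exact_functor_def by simp
  have S_ob: "ess_image CD F XX \<subseteq> Ob CD" and T_ob: "ess_image CD G YY \<subseteq> Ob CD"
    unfolding ess_image_def by auto
  have in_image: "FOb H P \<in> U"
    if H: "additive_functor CD CB H" and U: "ess_image CB H V \<subseteq> U" and V: "V \<subseteq> Ob CD" "P \<in> V"
    for H P U V
  proof -
    have "FOb H P \<in> Ob CB" using additive_functorD(1)[OF H] V by blast
    from B.mem_ess_image[OF V(2) this B.is_iso_id[OF this]] show ?thesis using U by blast
  qed
  interpret P: projective_transfer CB CD F L R u v XX YY "ess_image CD G YY"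
  proof (intro projective_transfer.intro projective_transfer_axioms.intro CB CD T_ob FL FR monic epic
      additive[OF F] functors(1,2) bal_X)
    show "xi_lower CB XX \<subseteq> xi_upper CB YY" by (rule equalityD1[OF bal_eq])
  qed (use triangles[OF F] in_image[OF functors(1) X(1) S_ob] in_image[OF functors(2) Y(1) T_ob] in \<open>fast+\<close>)
  interpret I: projective_transfer "op_cat CB" "op_cat CD" G R' L' v' u' YY XX "ess_image CD F XX"
  proof (intro projective_transfer.intro projective_transfer_axioms.intro
      B.op_extriangulated D.op_extriangulated,
      unfold D.ess_image_op additive_functor_op)
    show "ess_image CD F XX \<subseteq> Ob (op_cat CD)" using S_ob by simp
    show "YY = proj_obs (op_cat CB) (xi_lower (op_cat CB) YY)" using bal_Y(1) unfolding proj_obs_op .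
    show "enough_projectives (op_cat CB) (xi_lower (op_cat CB) YY)"
      using bal_Y(2) unfolding enough_projectives_op .
    show "xi_lower (op_cat CB) YY \<subseteq> xi_upper (op_cat CB) XX"
      using bal_eq by (simp add: subset_iff)
    show "adjunction (op_cat CB) (op_cat CD) G L' v' u'" by (rule adjunction_op[OF LG])
    show "\<exists>\<epsilon>. etriangle (op_cat CD) (FOb G A) (FMor G x) (FOb G B) (FMor G y) (FOb G X) \<epsilon>"
      if "etriangle (op_cat CB) A x B y X \<delta>" for A x B y X \<delta>
      using triangles[OF G] that by simp
  qed (use functors GR monic epic additive[OF G]
      in_image[OF functors(4) Y(2) T_ob] in_image[OF functors(3) X(2) S_ob] in simp_all)
  let ?S = "ess_image CD F XX" and ?T = "ess_image CD G YY"
  note T = D.ess_image_op[of G YY]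
  have "xi_lower CD ?S \<subseteq> xi_upper CD ?T"
    using P.xi_lower_subset_xi_upper by auto
  moreover have "xi_upper CD ?T \<subseteq> xi_lower CD ?S"
    using I.xi_lower_subset_xi_upper[unfolded T xi_lower_op xi_upper_op] by auto
  ultimately have "xi_lower CD ?S = xi_upper CD ?T" by (rule equalityI)
  moreover have "?T = inj_obs CD (xi_upper CD ?T)"
    using I.S_proj unfolding T proj_obs_op .
  moreover have "enough_injectives CD (xi_upper CD ?T)"
    using I.S_enough unfolding T enough_projectives_op .
  moreover have "full_additive_subcategory CD ?T" "closed_under_summands CD ?T"
    using I.S_full_additive I.S_closed_under_summands unfolding T by simp_all
  ultimately show ?thesis
    unfolding balanced_pair_def
    using P.S_proj P.S_enough P.S_full_additive P.S_closed_under_summands by blast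
qed

text \<open>
The kernel of \<open>C(F X, A) \<rightarrow> C(F X, B')\<close> is the image of \<open>E\<^sup>-\<^sup>1(F X, D) = 0\<close>. For an object \<open>P\<close> that is only
isomorphic to \<open>F X\<close>, maps are moved along the isomorphism.
\<close>

lemma inflations_monic_on_image:
  assumes C: "extriangulated_category C" and N: "negative_first_extension C N"
    and F: "additive_functor B C F" and S: "S \<subseteq> Ob B"
    and triv: "\<And>X D. \<lbrakk>X \<in> S; D \<in> Ob C\<rbrakk> \<Longrightarrow> trivial_group (BOb (NExt N) (FOb F X) D)"
  shows "inflations_monic_on C (ess_image C F S)"
  unfolding inflations_monic_on_def
proof (intro allI ballI impI)
  interpret extriangulated_category C by (rule C)
  fix A f B' g D \<delta> P u
  assume T: "etriangle C A f B' g D \<delta>" and P: "P \<in> ess_image C F S" and u: "u \<in> Mor C P A"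
    and fu: "f \<cdot>\<^bsub>C\<^esub> u = \<one>\<^bsub>Hom C P B'\<^esub>"
  note d = etriangle_data[OF T]
  obtain X h where X: "X \<in> S" and h: "is_iso C (FOb F X) P h" and Po: "P \<in> Ob C"
    using P unfolding ess_image_def by blast
  let ?X = "FOb F X"
  have Xo: "?X \<in> Ob C" using additive_functorD(1)[OF F] X S by blast
  have hm: "h \<in> Mor C ?X P" using h unfolding is_iso_def by simp
  obtain k where k: "k \<in> Mor C P ?X" "h \<cdot>\<^bsub>C\<^esub> k = Idn C P" using h unfolding is_iso_def by blast
  have uh: "u \<cdot>\<^bsub>C\<^esub> h \<in> Mor C ?X A" using comp_closed[OF Xo Po d(1) hm u] .
  have "f \<cdot>\<^bsub>C\<^esub> (u \<cdot>\<^bsub>C\<^esub> h) = \<one>\<^bsub>Hom C ?X B'\<^esub>"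
    using comp_assoc[OF Xo Po d(1,2) hm u d(4)] fu comp_zero_left[OF Xo Po d(2) hm] by simp
  moreover have ex: "exact_at (BOb (NExt N) ?X D) (Hom C ?X A) (Hom C ?X B')
      (sharp_lower N D A \<delta> ?X) (\<lambda>u. f \<cdot>\<^bsub>C\<^esub> u)"
    using negative_first_extension.neg_exact_lower[OF N T Xo] by blast
  ultimately have "u \<cdot>\<^bsub>C\<^esub> h \<in> sharp_lower N D A \<delta> ?X ` carrier (BOb (NExt N) ?X D)"
    using uh unfolding exact_at_def kernel_def by simp
  moreover have "sharp_lower N D A \<delta> ?X \<one>\<^bsub>BOb (NExt N) ?X D\<^esub> = \<one>\<^bsub>Hom C ?X A\<^esub>"
    by (rule hom_one[OF _ _ hom_group[OF Xo d(1)]])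
      (use ex triv[OF X d(3)] in \<open>simp_all add: exact_at_def trivial_group_def\<close>)
  ultimately have "u \<cdot>\<^bsub>C\<^esub> h = \<one>\<^bsub>Hom C ?X A\<^esub>"
    using triv[OF X d(3)] unfolding trivial_group_def by auto
  moreover have "u = (u \<cdot>\<^bsub>C\<^esub> h) \<cdot>\<^bsub>C\<^esub> k"
    using comp_assoc[OF Po Xo Po d(1) k(1) hm u] k(2) id_right[OF Po d(1) u] by simp
  ultimately show "u = \<one>\<^bsub>Hom C P A\<^esub>" using comp_zero_left[OF Po Xo d(1) k(1)] by simp
qed

lemma deflations_epic_on_image:
  assumes C: "extriangulated_category C" and N: "negative_first_extension C N"
    and F: "additive_functor B C F" and S: "S \<subseteq> Ob B"
    and triv: "\<And>X A. \<lbrakk>X \<in> S; A \<in> Ob C\<rbrakk> \<Longrightarrow> trivial_group (BOb (NExt N) A (FOb F X))"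
  shows "deflations_epic_on C (ess_image C F S)"
  unfolding deflations_epic_on_def
proof (intro allI ballI impI)
  interpret extriangulated_category C by (rule C)
  fix A f B' g D \<delta> P u
  assume T: "etriangle C A f B' g D \<delta>" and P: "P \<in> ess_image C F S" and u: "u \<in> Mor C D P"
    and ug: "u \<cdot>\<^bsub>C\<^esub> g = \<one>\<^bsub>Hom C B' P\<^esub>"
  note d = etriangle_data[OF T]
  obtain X h where X: "X \<in> S" and h: "is_iso C (FOb F X) P h" and Po: "P \<in> Ob C"
    using P unfolding ess_image_def by blast
  let ?X = "FOb F X"
  have Xo: "?X \<in> Ob C" using additive_functorD(1)[OF F] X S by blast
  have hm: "h \<in> Mor C ?X P" using h unfolding is_iso_def by simp
  obtain k where k: "k \<in> Mor C P ?X" "h \<cdot>\<^bsub>C\<^esub> k = Idn C P" using h unfolding is_iso_def by blast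
  have ku: "k \<cdot>\<^bsub>C\<^esub> u \<in> Mor C D ?X" using comp_closed[OF d(3) Po Xo u k(1)] .
  have "(k \<cdot>\<^bsub>C\<^esub> u) \<cdot>\<^bsub>C\<^esub> g = \<one>\<^bsub>Hom C B' ?X\<^esub>"
    using comp_assoc[OF d(2,3) Po Xo d(5) u k(1)] ug comp_zero_right[OF d(2) Po Xo k(1)] by simp
  moreover have ex: "exact_at (BOb (NExt N) A ?X) (Hom C D ?X) (Hom C B' ?X)
      (sharp_upper N D A \<delta> ?X) (\<lambda>u. u \<cdot>\<^bsub>C\<^esub> g)"
    using negative_first_extension.neg_exact_upper[OF N T Xo] by blast
  ultimately have "k \<cdot>\<^bsub>C\<^esub> u \<in> sharp_upper N D A \<delta> ?X ` carrier (BOb (NExt N) A ?X)"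
    using ku unfolding exact_at_def kernel_def by simp
  moreover have "sharp_upper N D A \<delta> ?X \<one>\<^bsub>BOb (NExt N) A ?X\<^esub> = \<one>\<^bsub>Hom C D ?X\<^esub>"
    by (rule hom_one[OF _ _ hom_group[OF d(3) Xo]])
      (use ex triv[OF X d(1)] in \<open>simp_all add: exact_at_def trivial_group_def\<close>)
  ultimately have "k \<cdot>\<^bsub>C\<^esub> u = \<one>\<^bsub>Hom C D ?X\<^esub>"
    using triv[OF X d(1)] unfolding trivial_group_def by auto
  moreover have "u = h \<cdot>\<^bsub>C\<^esub> (k \<cdot>\<^bsub>C\<^esub> u)"
    using comp_assoc[OF d(3) Po Xo Po u k(1) hm] k(2) id_left[OF d(3) Po u] by simp
  ultimately show "u = \<one>\<^bsub>Hom C D P\<^esub>" using comp_zero_right[OF d(3) Xo Po hm] by simp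
qed

theorem theorem4p6:
  fixes CA :: "('oa, 'ma, 'ea) extricat"
    and CB :: "('ob, 'mb, 'eb) extricat"
    and CC :: "('oc, 'mc, 'ec) extricat"
    and NA :: "('oa, 'ma, 'ea, 'na) negext"
    and NB :: "('ob, 'mb, 'eb, 'nb) negext"
    and NC :: "('oc, 'mc, 'ec, 'nc) negext"
    and i_pull i_shriek :: "('ob, 'mb, 'oa, 'ma) functor_data"
    and i_push :: "('oa, 'ma, 'ob, 'mb) functor_data"
    and j_shriek j_push :: "('oc, 'mc, 'ob, 'mb) functor_data"
    and j_pull :: "('ob, 'mb, 'oc, 'mc) functor_data"
    and XX YY :: "'ob set"
  assumes "extriangulated_category CA" and "extriangulated_category CB"
    and "extriangulated_category CC"
    and "negative_first_extension CA NA" and "negative_first_extension CB NB"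
    and "negative_first_extension CC NC"
    and "WIC CA" and "WIC CB" and "WIC CC"
    and "recollement CA CB CC i_pull i_push i_shriek j_shriek j_pull j_push"
    and "balanced_pair CB XX YY"
    and "ess_image CB j_shriek (ess_image CC j_pull XX) \<subseteq> XX"
    and "ess_image CB j_push (ess_image CC j_pull YY) \<subseteq> YY"
    and "ess_image CB i_push (ess_image CA i_pull XX) \<subseteq> XX"
    and "ess_image CB i_push (ess_image CA i_shriek YY) \<subseteq> YY"
  shows "((\<forall>D \<in> Ob CC. \<forall>Y \<in> YY. trivial_group (BOb (NExt NC) D (FOb j_pull Y))) \<and>
          (\<forall>X \<in> XX. \<forall>D \<in> Ob CC. trivial_group (BOb (NExt NC) (FOb j_pull X) D)) \<longrightarrow>
          balanced_pair CC (ess_image CC j_pull XX) (ess_image CC j_pull YY)) \<and>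
         (exact_functor CB CA i_pull \<and> exact_functor CB CA i_shriek \<and>
          (\<forall>X \<in> XX. \<forall>A \<in> Ob CA. trivial_group (BOb (NExt NA) (FOb i_pull X) A)) \<and>
          (\<forall>A \<in> Ob CA. \<forall>Y \<in> YY. trivial_group (BOb (NExt NA) A (FOb i_shriek Y))) \<longrightarrow>
          balanced_pair CA (ess_image CA i_pull XX) (ess_image CA i_shriek YY))"
proof -
  note A = assms(1) and B = assms(2) and C = assms(3)
  note pre = A[THEN extriangulated_category.axioms(1), THEN additive_category.axioms(1)]
    B[THEN extriangulated_category.axioms(1), THEN additive_category.axioms(1)]
    C[THEN extriangulated_category.axioms(1), THEN additive_category.axioms(1)]
  have pre_op: "preadditive_category (op_cat CB)" "preadditive_category (op_cat CC)"
    using B C extriangulated_category.op_additive additive_category.axioms(1) by blast+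
  note rec = assms(10)[unfolded recollement_def]
  have ex: "exact_functor CB CC j_pull"
    and add: "additive_functor CA CB i_push" "additive_functor CB CC j_pull"
      "additive_functor CB CA i_pull" "additive_functor CC CB j_shriek"
      "additive_functor CB CA i_shriek" "additive_functor CC CB j_push"
    and ff: "fully_faithful CA CB i_push" "fully_faithful CC CB j_shriek" "fully_faithful CC CB j_push"
    using rec unfolding exact_functor_def right_exact_functor_def left_exact_functor_def by simp_all
  obtain u1 v1 u2 v2 u3 v3 u4 v4 where adj: "adjunction CB CA i_pull i_push u1 v1"
    "adjunction CA CB i_push i_shriek u2 v2" "adjunction CC CB j_shriek j_pull u3 v3"
    "adjunction CB CC j_pull j_push u4 v4"
    using rec by (elim conjE exE) blast
  have XY: "XX \<subseteq> Ob CB" "YY \<subseteq> Ob CB"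
    using assms(11) unfolding balanced_pair_def full_additive_subcategory_def by simp_all
  have 1: "balanced_pair CC (ess_image CC j_pull XX) (ess_image CC j_pull YY)"
    if van: "\<forall>D \<in> Ob CC. \<forall>Y \<in> YY. trivial_group (BOb (NExt NC) D (FOb j_pull Y))"
      "\<forall>X \<in> XX. \<forall>D \<in> Ob CC. trivial_group (BOb (NExt NC) (FOb j_pull X) D)"
  proof (rule balanced_pair_transfer[OF B C ex ex add(4,6,4,6) adj(4,3) _ _
        assms(11,12,12,13,13)])
    show "left_inverse_functor CC j_pull j_shriek"
      by (rule right_adjoint_left_inverse[OF pre(3,2) add(4,2) adj(3) ff(2)])
    show "left_inverse_functor (op_cat CC) j_pull j_push"
      using right_adjoint_left_inverse[OF pre_op(2,1) _ _ adjunction_op[OF adj(4)]] add(6,2) ff(3)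
      by (simp add: additive_functor_op fully_faithful_op)
    show "inflations_monic_on CC (ess_image CC j_pull XX)"
      using inflations_monic_on_image[OF C assms(6) add(2) XY(1)] van by blast
    show "deflations_epic_on CC (ess_image CC j_pull YY)"
      using deflations_epic_on_image[OF C assms(6) add(2) XY(2)] van by blast
  qed
  have 2: "balanced_pair CA (ess_image CA i_pull XX) (ess_image CA i_shriek YY)"
    if exact: "exact_functor CB CA i_pull" "exact_functor CB CA i_shriek"
      and van: "\<forall>X \<in> XX. \<forall>A \<in> Ob CA. trivial_group (BOb (NExt NA) (FOb i_pull X) A)"
        "\<forall>A \<in> Ob CA. \<forall>Y \<in> YY. trivial_group (BOb (NExt NA) A (FOb i_shriek Y))"
  proof (rule balanced_pair_transfer[OF B A exact add(1,1,1,1) adj(1,2) _ _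
        assms(11,14,14,15,15)])
    show "left_inverse_functor CA i_pull i_push"
      by (rule left_adjoint_left_inverse[OF B A add(3,1) adj(1) ff(1)])
    show "left_inverse_functor (op_cat CA) i_shriek i_push"
      using left_adjoint_left_inverse[OF extriangulated_category.op_extriangulated[OF B]
          extriangulated_category.op_extriangulated[OF A] _ _ adjunction_op[OF adj(2)]] add(5,1) ff(1)
      by (simp add: additive_functor_op fully_faithful_op)
    show "inflations_monic_on CA (ess_image CA i_pull XX)"
      using inflations_monic_on_image[OF A assms(4) add(3) XY(1)] van by blast
    show "deflations_epic_on CA (ess_image CA i_shriek YY)"
      using deflations_epic_on_image[OF A assms(4) add(5) XY(2)] van by blast
  qed
  show ?thesis using 1 2 by blast
qed

end
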